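(* Let $\lambda\in\mathbb R$ and let $\mathbf F\subset\mathcal P_2(\mathsf{TX})$ be a $\lambda$-dissipative MPVF such that the Explicit Euler scheme is locally solvable in $\mathrm D(\mathbf F)$ (i.e. at every point of $\mathrm D(\mathbf F)$). Let $\mu^1,\mu^2:[0,T)\to\overline{\mathrm D(\mathbf F)}$, $T\in(0,+\infty]$, be $\lambda$-EVI solutions for $\mathbf F$. If $\mu^1$ is strict, then $$W_2(\mu^1_t,\mu^2_t)\le W_2(\mu^1_0,\mu^2_0)\,e^{\lambda_+t}\qquad\text{for every }t\in[0,T),$$ where $\lambda_+=\max\{\lambda,0\}$. In particular, if $\mu^1_0=\mu^2_0$ then $\mu^1\equiv\mu^2$ in $[0,T)$. If $\mu^1,\mu^2$ are both strict, then $$W_2(\mu^1_t,\mu^2_t)\le W_2(\mu^1_0,\mu^2_0)\,e^{\lambda t}\qquad\text{for every }t\in[0,T).$$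
   Context: $\mathsf X$ is a separable real Hilbert space (possibly infinite dimensional) with norm $|\cdot|$. $\mathcal P_2(\mathsf X)$ is the set of Borel probability measures on $\mathsf X$ with finite second moment, endowed with the $L^2$-Wasserstein distance $W_2$. $\mathsf{TX}:=\mathsf X\times\mathsf X$ with points $(x,v)$; $\mathsf x(x,v):=x$, $\exp^t(x,v):=x+tv$. $\mathcal P_2(\mathsf{TX})$ is the set of Borel probability measures $\Phi$ on $\mathsf{TX}$ with $\int(|x|^2+|v|^2)\,d\Phi<\infty$, and $|\Phi|_2^2:=\int|v|^2\,d\Phi(x,v)$. Pairings: for $\Phi,\Psi\in\mathcal P_2(\mathsf{TX})$ and $\nu\in\mathcal P_2(\mathsf X)$ (the limits exist), $$[\Phi,\nu]_r:=\lim_{s\downarrow0}\frac{W_2^2(\exp^s_\sharp\Phi,\nu)-W_2^2(\mathsf x_\sharp\Phi,\nu)}{2s},\qquad [\Phi,\Psi]_r:=\lim_{s\downarrow0}\frac{W_2^2(\exp^s_\sharp\Phi,\exp^s_\sharp\Psi)-W_2^2(\mathsf x_\sharp\Phi,\mathsf x_\sharp\Psi)}{2s}.$$ A multivalued probability vector field (MPVF) is a nonempty subset $\mathbf F\subset\mathcal P_2(\mathsf{TX})$; $\mathrm D(\mathbf F):=\{\mathsf x_\sharp\Phi:\Phi\in\mathbf F\}$, $\mathbf F[\mu]:=\{\Phi\in\mathbf F:\mathsf x_\sharp\Phi=\mu\}$; $\overline{\mathrm D(\mathbf F)}$ is the closure in $(\mathcal P_2(\mathsf X),W_2)$. $\mathbf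 F$ is $\lambda$-dissipative if $[\Phi_0,\Phi_1]_r\le\lambda W_2^2(\mathsf x_\sharp\Phi_0,\mathsf x_\sharp\Phi_1)$ for all $\Phi_0,\Phi_1\in\mathbf F$. A $\lambda$-EVI solution for $\mathbf F$ on an interval $\mathcal I\subset\mathbb R$ is a continuous curve $\mu:\mathcal I\to\overline{\mathrm D(\mathbf F)}$ such that for every $\Phi\in\mathbf F$, with $\nu=\mathsf x_\sharp\Phi$, one has $\frac12\frac{d}{dt}W_2^2(\mu_t,\nu)\le\lambda W_2^2(\mu_t,\nu)-[\Phi,\mu_t]_r$ in the sense of distributions in the interior of $\mathcal I$. It is strict if $\mu_t\in\mathrm D(\mathbf F)$ for every $t\in\mathcal I$, $t>\inf\mathcal I$. Explicit Euler scheme: given $\tau,T,L>0$ and $\mu^0\in\mathrm D(\mathbf F)$, put $N:=\lceil T/\tau\rceil$. An $L$-stable discrete solution in $[0,T]$ with step $\tau$ starting from $\mu^0$ consists of $M^n\in\mathrm D(\mathbf F)$, $0\le n\le N$, and $\Phi^n\in\mathbf F[M^n]$, $0\le n<N$, with $M^0=\mu^0$, $|\Phi^n|_2\le L$ and $M^{n+1}=\exp^\tau_\sharp\Phi^n$ for $0\le n<N$. The scheme is locally solvable at $\mu_0\in\mathrm D(\mathbf F)$ if there exist constants $\bar\tau,T,L>0$ such that for every $\tau\in(0,\bar\tau)$ there is an $L$-stable discrete solution in $[0,T]$ with step $\tau$ starting from $\mu_0$. *)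

theory Defs
  imports "HOL-Probability.Probability"
begin

text \<open>The class constraint \<open>{real_inner, polish_space}\<close> expresses a separable real Hilbert space:
  for metric spaces, second countability is separability.  The tangent bundle is the product
  type, whose Borel sets form the product sigma-algebra.\<close>

definition P2 :: "'a::{real_inner, polish_space} measure set" where
  "P2 = {\<mu>. prob_space \<mu> \<and> sets \<mu> = sets borel \<and>
             (\<integral>\<^sup>+ x. ennreal ((norm x)\<^sup>2) \<partial>\<mu>) < \<infinity>}"

definition P2T :: "('a::{real_inner, polish_space} \<times> 'a) measure set" where
  "P2T = {\<Phi>. prob_space \<Phi> \<and> sets \<Phi> = sets borel \<and>
             (\<integral>\<^sup>+ (x, v). ennreal ((norm x)\<^sup>2 + (norm v)\<^sup>2) \<partial>\<Phi>) < \<infinity>}"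

definition couplings ::
    "'a::{real_inner, polish_space} measure \<Rightarrow> 'a measure \<Rightarrow> ('a \<times> 'a) measure set" where
  "couplings \<mu> \<nu> = {\<gamma>. sets \<gamma> = sets borel \<and> distr \<gamma> borel fst = \<mu> \<and> distr \<gamma> borel snd = \<nu>}"

text \<open>The infimum is finite for measures in \<open>P2\<close>, so \<open>enn2real\<close> loses nothing there.\<close>

definition W2 :: "'a::{real_inner, polish_space} measure \<Rightarrow> 'a measure \<Rightarrow> real" where
  "W2 \<mu> \<nu> = sqrt (enn2real (INF \<gamma>\<in>couplings \<mu> \<nu>. \<integral>\<^sup>+ (x, y). ennreal ((norm (x - y))\<^sup>2) \<partial>\<gamma>))"

definition W2_closure ::
    "'a::{real_inner, polish_space} measure set \<Rightarrow> 'a measure set" where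
  "W2_closure A = {\<mu>\<in>P2. \<forall>\<epsilon>>0. \<exists>\<nu>\<in>A. W2 \<mu> \<nu> < \<epsilon>}"

definition W2_continuous_on ::
    "real set \<Rightarrow> (real \<Rightarrow> 'a::{real_inner, polish_space} measure) \<Rightarrow> bool" where
  "W2_continuous_on I \<mu> \<longleftrightarrow> (\<forall>t\<in>I. ((\<lambda>s. W2 (\<mu> s) (\<mu> t)) \<longlongrightarrow> 0) (at t within I))"

definition base :: "('a::{real_inner, polish_space} \<times> 'a) measure \<Rightarrow> 'a measure" where
  "base \<Phi> = distr \<Phi> borel fst"

definition exp_push ::
    "real \<Rightarrow> ('a::{real_inner, polish_space} \<times> 'a) measure \<Rightarrow> 'a measure" where
  "exp_push s \<Phi> = distr \<Phi> borel (\<lambda>(x, v). x + s *\<^sub>R v)"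

definition speed :: "('a::{real_inner, polish_space} \<times> 'a) measure \<Rightarrow> real" where
  "speed \<Phi> = sqrt (\<integral>(x, v). (norm v)\<^sup>2 \<partial>\<Phi>)"

text \<open>On \<open>P2T\<close> and \<open>P2\<close> both difference quotients converge, so that \<open>Lim\<close> is the actual limit.\<close>

definition pairing_point ::
    "('a::{real_inner, polish_space} \<times> 'a) measure \<Rightarrow> 'a measure \<Rightarrow> real" where
  "pairing_point \<Phi> \<nu> =
     Lim (at_right 0) (\<lambda>s. ((W2 (exp_push s \<Phi>) \<nu>)\<^sup>2 - (W2 (base \<Phi>) \<nu>)\<^sup>2) / (2 * s))"

definition pairing_field ::
    "('a::{real_inner, polish_space} \<times> 'a) measure \<Rightarrow> ('a \<times> 'a) measure \<Rightarrow> real" where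
  "pairing_field \<Phi> \<Psi> =
     Lim (at_right 0)
       (\<lambda>s. ((W2 (exp_push s \<Phi>) (exp_push s \<Psi>))\<^sup>2 - (W2 (base \<Phi>) (base \<Psi>))\<^sup>2) / (2 * s))"

definition MPVF :: "('a::{real_inner, polish_space} \<times> 'a) measure set \<Rightarrow> bool" where
  "MPVF F \<longleftrightarrow> F \<noteq> {} \<and> F \<subseteq> P2T"

definition Dom :: "('a::{real_inner, polish_space} \<times> 'a) measure set \<Rightarrow> 'a measure set" where
  "Dom F = base ` F"

definition section_at ::
    "('a::{real_inner, polish_space} \<times> 'a) measure set \<Rightarrow> 'a measure \<Rightarrow> ('a \<times> 'a) measure set" where
  "section_at F \<mu> = {\<Phi>\<in>F. base \<Phi> = \<mu>}"

definition dissipative ::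
    "real \<Rightarrow> ('a::{real_inner, polish_space} \<times> 'a) measure set \<Rightarrow> bool" where
  "dissipative lam F \<longleftrightarrow>
     (\<forall>\<Phi>\<in>F. \<forall>\<Psi>\<in>F. pairing_field \<Phi> \<Psi> \<le> lam * (W2 (base \<Phi>) (base \<Psi>))\<^sup>2)"

text \<open>Nonnegative smooth functions with compact support in the open set \<open>J\<close>.\<close>

definition nonneg_test_function :: "real set \<Rightarrow> (real \<Rightarrow> real) \<Rightarrow> bool" where
  "nonneg_test_function J \<phi> \<longleftrightarrow>
     (\<forall>n t. ((deriv ^^ n) \<phi>) differentiable (at t)) \<and>
     compact (closure {t. \<phi> t \<noteq> 0}) \<and> closure {t. \<phi> t \<noteq> 0} \<subseteq> J \<and> (\<forall>t. 0 \<le> \<phi> t)"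

text \<open>The inequality \<open>u' \<le> g\<close> in the sense of distributions in \<open>J\<close>, for \<open>u\<close> and \<open>g\<close> locally
  integrable in \<open>J\<close>.  Values of \<open>u\<close> and \<open>g\<close> outside \<open>J\<close> do not matter, since test functions and
  their derivatives vanish there.\<close>

definition distr_deriv_le :: "real set \<Rightarrow> (real \<Rightarrow> real) \<Rightarrow> (real \<Rightarrow> real) \<Rightarrow> bool" where
  "distr_deriv_le J u g \<longleftrightarrow>
     (\<forall>\<phi>. nonneg_test_function J \<phi> \<longrightarrow>
        - (\<integral>t. u t * deriv \<phi> t \<partial>lborel) \<le> (\<integral>t. g t * \<phi> t \<partial>lborel))"

text \<open>Local integrability in the interior of \<open>I\<close> is automatic along a continuous curve: the squared
  distance is continuous in \<open>t\<close>, and \<open>pairing_point \<Phi>\<close> is a pointwise limit of continuous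
  functions bounded in absolute value by \<open>speed \<Phi> * W2 (base \<Phi>) \<nu>\<close>.\<close>

definition EVI_solution ::
    "real \<Rightarrow> ('a::{real_inner, polish_space} \<times> 'a) measure set \<Rightarrow> real set \<Rightarrow>
     (real \<Rightarrow> 'a measure) \<Rightarrow> bool" where
  "EVI_solution lam F I \<mu> \<longleftrightarrow>
     (\<forall>t\<in>I. \<mu> t \<in> W2_closure (Dom F)) \<and> W2_continuous_on I \<mu> \<and>
     (\<forall>\<Phi>\<in>F. distr_deriv_le (interior I)
        (\<lambda>t. (1/2) * (W2 (\<mu> t) (base \<Phi>))\<^sup>2)
        (\<lambda>t. lam * (W2 (\<mu> t) (base \<Phi>))\<^sup>2 - pairing_point \<Phi> (\<mu> t)))"

text \<open>The infimum is taken in the extended reals so that it is correct for \<open>I\<close> unbounded below.\<close>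

definition strict_on ::
    "('a::{real_inner, polish_space} \<times> 'a) measure set \<Rightarrow> real set \<Rightarrow>
     (real \<Rightarrow> 'a measure) \<Rightarrow> bool" where
  "strict_on F I \<mu> \<longleftrightarrow> (\<forall>t\<in>I. (INF s\<in>I. ereal s) < ereal t \<longrightarrow> \<mu> t \<in> Dom F)"

definition stable_discrete_solution ::
    "('a::{real_inner, polish_space} \<times> 'a) measure set \<Rightarrow> real \<Rightarrow> real \<Rightarrow> real \<Rightarrow> 'a measure \<Rightarrow>
     (nat \<Rightarrow> 'a measure) \<Rightarrow> (nat \<Rightarrow> ('a \<times> 'a) measure) \<Rightarrow> bool" where
  "stable_discrete_solution F L T \<tau> \<mu>0 M \<Phi> \<longleftrightarrow>
     (let N = nat \<lceil>T / \<tau>\<rceil> in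
        M 0 = \<mu>0 \<and>
        (\<forall>n\<le>N. M n \<in> Dom F) \<and>
        (\<forall>n<N. \<Phi> n \<in> section_at F (M n) \<and> speed (\<Phi> n) \<le> L \<and> M (Suc n) = exp_push \<tau> (\<Phi> n)))"

definition Euler_locally_solvable_at ::
    "('a::{real_inner, polish_space} \<times> 'a) measure set \<Rightarrow> 'a measure \<Rightarrow> bool" where
  "Euler_locally_solvable_at F \<mu>0 \<longleftrightarrow>
     (\<exists>\<tau>bar T L. 0 < \<tau>bar \<and> 0 < T \<and> 0 < L \<and>
        (\<forall>\<tau>. 0 < \<tau> \<and> \<tau> < \<tau>bar \<longrightarrow> (\<exists>M \<Phi>. stable_discrete_solution F L T \<tau> \<mu>0 M \<Phi>)))"

end

theory Submission
  imports Defs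
begin

text \<open>
  Two evolutions are compared through an explicit Euler path that is started on the strict one.
  Let \<open>\<mu>1\<close> be strict, fix \<open>t0 > 0\<close>, and let \<open>M\<^sup>n\<close> be a discrete solution with step \<open>\<tau>\<close> and
  selections \<open>\<Phi>\<^sup>n\<close>, starting from \<open>\<mu>1 t0\<close>, which lies in the domain.  For any EVI solution \<open>\<mu>\<close>
  put \<open>e n t = W2(\<mu> t, M\<^sup>n)\<^sup>2 / 2\<close>.  Two inequalities involve the same pairing with opposite signs:
  the EVI tested against \<open>\<Phi>\<^sup>n\<close> bounds the time derivative of \<open>e n\<close> by
  \<open>2 lam e n t - [\<Phi>\<^sup>n, \<mu> t]\<close>, and semiconcavity of the squared distance along
  \<open>s \<mapsto> exp\<^sup>s \<Phi>\<^sup>n\<close> bounds \<open>(e (n+1) t - e n t) / \<tau>\<close> by \<open>[\<Phi>\<^sup>n, \<mu> t] + \<tau> L\<^sup>2 / 2\<close>.  Adding them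
  removes the pairing and leaves the differential-difference inequality
  \<open>(e n)' + (e (n+1) - e n) / \<tau> \<le> 2 lam e n + \<tau> L\<^sup>2 / 2\<close>,
  a transport inequality in the two variables \<open>t\<close> and \<open>n \<tau>\<close>.

  Summing it over a staircase-shaped strip \<open>{(t, n). j \<le> n < j + k, t \<in> [j \<tau>, (j+1) \<tau>]}\<close> along
  the diagonal, the difference quotients telescope.  A downwind scheme such as this one
  amplifies errors when it is iterated row by row; in the sum, only the oscillation of \<open>\<mu>\<close> over one
  time step enters, divided by the width \<open>k \<tau>\<close> of the strip.  If \<open>\<tau>\<close> tends to zero first and the
  width afterwards, a discrete Gronwall argument gives, in the limit,
  \<open>W2(\<mu> (t0 + h), M) \<le> exp (lam h) W2(\<mu> t0, \<mu>1 t0)\<close>, where \<open>M\<close> is the Euler point at time \<open>h\<close>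
  (\<open>Euler_follows_EVI\<close>).  For \<open>\<mu> = \<mu>1\<close> the right-hand side vanishes, that is, the
  scheme converges to \<open>\<mu>1\<close>; for \<open>\<mu> = \<mu>2\<close> it is the wanted bound.  The triangle inequality then
  yields the contraction on a short interval to the right of every \<open>t0 > 0\<close>
  (\<open>EVI_locally_contractive\<close>), and a continuity argument extends it to the
  whole interval (\<open>EVI_contractive\<close>).  Equality of the curves follows because \<open>W2\<close> separates
  measures (\<open>W2_zero_imp_eq\<close>).

  The metric facts about \<open>W2\<close> rest on a gluing lemma for couplings.  Disintegration is avoided:
  after partitioning the space into countably many cells of small diameter, two couplings can be
  glued by a density that is constant on pairs of cells, at the price of an arbitrarily small
  displacement (\<open>approximate_gluing\<close>).
\<close>

section \<open>Gluing along a countable partition\<close>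

lemma (in prob_space) AE_label_positive:
  fixes i :: "'a \<Rightarrow> nat"
  assumes [measurable]: "i \<in> measurable M (count_space UNIV)"
  shows "AE x in M. emeasure M {y\<in>space M. i y = i x} \<noteq> 0"
proof -
  have "AE x in M. i x = n \<longrightarrow> emeasure M {y\<in>space M. i y = n} \<noteq> 0" for n
  proof (cases "emeasure M {y\<in>space M. i y = n} = 0")
    case True
    then have "AE x in M. i x \<noteq> n" by (subst AE_iff_measurable) auto
    then show ?thesis by eventually_elim simp
  qed simp
  then have "AE x in M. \<forall>n. i x = n \<longrightarrow> emeasure M {y\<in>space M. i y = n} \<noteq> 0"
    by (subst AE_all_countable) blast
  then show ?thesis by eventually_elim simp
qed

text \<open>The measure is the product reweighted by
  \<open>1 / P(label)\<close> where the labels agree: conditionally on the common label the two coordinates are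
  independent.  Labels of probability zero get an infinite weight, but only on a null set.\<close>

lemma glue_along_labels:
  fixes i :: "'a \<Rightarrow> nat" and j :: "'b \<Rightarrow> nat"
  assumes "prob_space M" "prob_space N"
    and i[measurable]: "i \<in> measurable M (count_space UNIV)"
    and j[measurable]: "j \<in> measurable N (count_space UNIV)"
    and same: "\<And>n. emeasure M {x\<in>space M. i x = n} = emeasure N {y\<in>space N. j y = n}"
  obtains P where "sets P = sets (M \<Otimes>\<^sub>M N)" "distr P M fst = M" "distr P N snd = N"
    "AE z in P. i (fst z) = j (snd z)"
proof -
  interpret M: prob_space M by fact
  interpret N: prob_space N by fact
  interpret MN: pair_sigma_finite M N ..
  define p where "p n = emeasure M {x\<in>space M. i x = n}" for n
  define w :: "'a \<times> 'b \<Rightarrow> ennreal" where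
    "w = (\<lambda>z. if i (fst z) = j (snd z) then inverse (p (i (fst z))) else 0)"

  have w[measurable]: "w \<in> borel_measurable (M \<Otimes>\<^sub>M N)"
  proof -
    have "(\<lambda>z. i (fst z)) \<in> measurable (M \<Otimes>\<^sub>M N) (count_space UNIV)" by measurable
    then have [measurable]: "(\<lambda>z. inverse (p (i (fst z)))) \<in> borel_measurable (M \<Otimes>\<^sub>M N)"
      by (rule measurable_compose) simp
    have "Measurable.pred (M \<Otimes>\<^sub>M N) (\<lambda>z. \<exists>n. i (fst z) = n \<and> j (snd z) = n)" by measurable
    also have "(\<lambda>z. \<exists>n. i (fst z) = n \<and> j (snd z) = n) = (\<lambda>z. i (fst z) = j (snd z))" by auto
    finally show ?thesis unfolding w_def by (intro measurable_If) (auto simp: pred_def)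
  qed
  have inv: "inverse (p n) * p n = 1" if "p n \<noteq> 0" for n
    using that M.emeasure_finite unfolding p_def
    by (metis ennreal_inverse_mult infinity_ennreal_def mult.commute top.not_eq_extremum M.emeasure_real ennreal_mult_strict_right_mono ennreal_divide_self divide_ennreal_def)
  define P where "P = density (M \<Otimes>\<^sub>M N) w"
  have setsP[measurable_cong]: "sets P = sets (M \<Otimes>\<^sub>M N)" by (simp add: P_def)
  have spP: "space P = space M \<times> space N" by (simp add: P_def space_pair_measure)
  have 1: "AE x in M. (\<integral>\<^sup>+ y. w (x, y) \<partial>N) = 1"
    using M.AE_label_positive[OF i] AE_space
  proof eventually_elim
    case (elim x)
    have "(\<integral>\<^sup>+ y. w (x, y) \<partial>N) = (\<integral>\<^sup>+ y. inverse (p (i x)) * indicator {y\<in>space N. j y = i x} y \<partial>N)"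
      by (intro nn_integral_cong) (auto simp: w_def indicator_def)
    also have "\<dots> = inverse (p (i x)) * p (i x)"
      by (subst nn_integral_cmult_indicator) (auto simp: same p_def)
    finally show ?case using inv elim by (simp add: p_def)
  qed
  have 2: "AE y in N. (\<integral>\<^sup>+ x. w (x, y) \<partial>M) = 1"
    using N.AE_label_positive[OF j] AE_space
  proof eventually_elim
    case (elim y)
    have "(\<integral>\<^sup>+ x. w (x, y) \<partial>M) = (\<integral>\<^sup>+ x. inverse (p (j y)) * indicator {x\<in>space M. i x = j y} x \<partial>M)"
      by (intro nn_integral_cong) (auto simp: w_def indicator_def)
    also have "\<dots> = inverse (p (j y)) * p (j y)"
      by (subst nn_integral_cmult_indicator) (auto simp: p_def)
    finally show ?case using inv elim by (simp add: p_def same)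
  qed
  have "distr P M fst = M"
  proof (rule measure_eqI)
    fix A assume "A \<in> sets (distr P M fst)"
    then have A[measurable]: "A \<in> sets M" by simp
    have "emeasure (distr P M fst) A = emeasure P (fst -` A \<inter> space P)"
      by (subst emeasure_distr) (auto simp: P_def)
    also have "\<dots> = (\<integral>\<^sup>+ z. w z * indicator (fst -` A \<inter> space P) z \<partial>(M \<Otimes>\<^sub>M N))"
      unfolding P_def by (subst emeasure_density) (auto)
    also have "\<dots> = (\<integral>\<^sup>+ z. indicator A (fst z) * w z \<partial>(M \<Otimes>\<^sub>M N))"
      by (intro nn_integral_cong) (auto simp: indicator_def spP space_pair_measure)
    also have "\<dots> = (\<integral>\<^sup>+ x. \<integral>\<^sup>+ y. indicator A x * w (x, y) \<partial>N \<partial>M)"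
      by (subst N.nn_integral_fst[symmetric]) auto
    also have "\<dots> = (\<integral>\<^sup>+ x. indicator A x * (\<integral>\<^sup>+ y. w (x, y) \<partial>N) \<partial>M)"
      by (intro nn_integral_cong nn_integral_cmult) measurable
    also have "\<dots> = (\<integral>\<^sup>+ x. indicator A x \<partial>M)"
    proof (rule nn_integral_cong_AE)
      show "AE x in M. indicator A x * (\<integral>\<^sup>+ y. w (x, y) \<partial>N) = indicator A x" using 1 by eventually_elim simp
    qed
    finally show "emeasure (distr P M fst) A = emeasure M A" by simp
  qed simp
  moreover have "distr P N snd = N"
  proof (rule measure_eqI)
    fix A assume "A \<in> sets (distr P N snd)"
    then have A[measurable]: "A \<in> sets N" by simp
    have "emeasure (distr P N snd) A = emeasure P (snd -` A \<inter> space P)"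
      by (subst emeasure_distr) (auto simp: P_def)
    also have "\<dots> = (\<integral>\<^sup>+ z. w z * indicator (snd -` A \<inter> space P) z \<partial>(M \<Otimes>\<^sub>M N))"
      unfolding P_def by (subst emeasure_density) (auto)
    also have "\<dots> = (\<integral>\<^sup>+ z. indicator A (snd z) * w z \<partial>(M \<Otimes>\<^sub>M N))"
      by (intro nn_integral_cong) (auto simp: indicator_def spP space_pair_measure)
    also have "\<dots> = (\<integral>\<^sup>+ y. \<integral>\<^sup>+ x. indicator A y * w (x, y) \<partial>M \<partial>N)"
      by (subst MN.nn_integral_snd[symmetric]) auto
    also have "\<dots> = (\<integral>\<^sup>+ y. indicator A y * (\<integral>\<^sup>+ x. w (x, y) \<partial>M) \<partial>N)"
      by (intro nn_integral_cong nn_integral_cmult) measurable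
    also have "\<dots> = (\<integral>\<^sup>+ y. indicator A y \<partial>N)"
    proof (rule nn_integral_cong_AE)
      show "AE y in N. indicator A y * (\<integral>\<^sup>+ x. w (x, y) \<partial>M) = indicator A y" using 2 by eventually_elim simp
    qed
    finally show "emeasure (distr P N snd) A = emeasure N A" by simp
  qed simp
  moreover have "AE z in P. i (fst z) = j (snd z)"
    unfolding P_def by (subst AE_density[OF w]) (auto simp: w_def)
  ultimately show ?thesis using setsP that by blast
qed

lemma small_cells:
  fixes \<epsilon> :: real
  assumes "\<epsilon> > 0"
  obtains c :: "'a::{metric_space, second_countable_topology} \<Rightarrow> nat" where
    "c \<in> measurable borel (count_space UNIV)" "\<And>x y. c x = c y \<Longrightarrow> dist x y \<le> \<epsilon>"
proof -
  obtain D :: "'a set" where D: "countable D" "\<And>X. open X \<Longrightarrow> X \<noteq> {} \<Longrightarrow> \<exists>d\<in>D. d \<in> X"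
    using countable_dense_setE by metis
  define d where "d = from_nat_into D"
  have "D \<noteq> {}" using D(2)[of UNIV] by auto
  have ex: "\<exists>n. dist x (d n) < \<epsilon> / 2" for x
  proof -
    obtain y where "y \<in> D" "y \<in> ball x (\<epsilon>/2)" using D(2)[of "ball x (\<epsilon>/2)"] assms by auto
    then show ?thesis using from_nat_into_surj[OF D(1)] unfolding d_def by fastforce
  qed
  define c where "c x = (LEAST n. dist x (d n) < \<epsilon> / 2)" for x
  have "c \<in> measurable borel (count_space UNIV)" unfolding c_def by measurable
  moreover have "dist x (d (c x)) < \<epsilon> / 2" for x unfolding c_def using ex LeastI_ex by fast
  then have "dist x y \<le> \<epsilon>" if "c x = c y" for x y
    using that by (smt (verit) dist_triangle2 dist_commute field_sum_of_halves)
  ultimately show ?thesis using that by blast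
qed

text \<open>Labelling points by cells of diameter at most \<open>\<epsilon>\<close> turns equality of laws into equality of
  countably many probabilities, which replaces a disintegration over the common marginal.\<close>

lemma approximate_gluing:
  fixes f :: "'a \<Rightarrow> 'c::{metric_space, second_countable_topology}" and g :: "'b \<Rightarrow> 'c"
  assumes "prob_space M" "prob_space N"
    and f[measurable]: "f \<in> borel_measurable M" and g[measurable]: "g \<in> borel_measurable N"
    and same: "distr M borel f = distr N borel g" and "\<epsilon> > 0"
  obtains P where "sets P = sets (M \<Otimes>\<^sub>M N)" "distr P M fst = M" "distr P N snd = N"
    "AE z in P. dist (f (fst z)) (g (snd z)) \<le> \<epsilon>"
proof -
  obtain c :: "'c \<Rightarrow> nat" where c[measurable]: "c \<in> measurable borel (count_space UNIV)"
    and small: "\<And>x y. c x = c y \<Longrightarrow> dist x y \<le> \<epsilon>" using small_cells[OF \<open>\<epsilon> > 0\<close>] by blast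
  have "emeasure M {x\<in>space M. c (f x) = n} = emeasure (distr M borel f) {y. c y = n}" for n
    by (subst emeasure_distr) (auto intro!: arg_cong2[where f=emeasure])
  moreover have "emeasure N {x\<in>space N. c (g x) = n} = emeasure (distr N borel g) {y. c y = n}" for n
    by (subst emeasure_distr) (auto intro!: arg_cong2[where f=emeasure])
  ultimately obtain P where P: "sets P = sets (M \<Otimes>\<^sub>M N)" "distr P M fst = M" "distr P N snd = N"
    "AE z in P. c (f (fst z)) = c (g (snd z))"
    using glue_along_labels[OF assms(1,2), of "\<lambda>x. c (f x)" "\<lambda>x. c (g x)"] same by auto
  from this(4) have "AE z in P. dist (f (fst z)) (g (snd z)) \<le> \<epsilon>"
    by (rule AE_mp) (auto intro: small)
  then show ?thesis using that P by blast
qed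

section \<open>The quadratic Wasserstein distance\<close>

lemma P2D:
  assumes "\<mu> \<in> P2"
  shows "prob_space \<mu>" "sets \<mu> = sets borel" "space \<mu> = UNIV"
    "(\<integral>\<^sup>+ x. ennreal ((norm x)\<^sup>2) \<partial>\<mu>) < \<infinity>"
proof -
  show *: "prob_space \<mu>" "sets \<mu> = sets borel" "(\<integral>\<^sup>+ x. ennreal ((norm x)\<^sup>2) \<partial>\<mu>) < \<infinity>"
    using assms by (auto simp: P2_def)
  show "space \<mu> = UNIV" using sets_eq_imp_space_eq[OF *(2)] by simp
qed

lemma W2_nonneg: "0 \<le> W2 \<mu> \<nu>"
  by (simp add: W2_def)

text \<open>Random variables on a common space are the most flexible way to exhibit a coupling; all upper
  bounds on the distance below come from this rule.\<close>

lemma W2_le_if_common_source: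
  fixes X Y :: "'b \<Rightarrow> 'a::{real_inner, polish_space}"
  assumes [measurable]: "X \<in> borel_measurable M" "Y \<in> borel_measurable M"
    and "distr M borel X = \<mu>" "distr M borel Y = \<nu>" "0 \<le> A"
    and cost: "(\<integral>\<^sup>+ z. ennreal ((norm (X z - Y z))\<^sup>2) \<partial>M) \<le> ennreal (A\<^sup>2)"
  shows "W2 \<mu> \<nu> \<le> A"
proof -
  define \<gamma> where "\<gamma> = distr M borel (\<lambda>z. (X z, Y z))"
  have 0[measurable]: "(\<lambda>z. (X z, Y z)) \<in> borel_measurable M" by measurable
  have "distr \<gamma> borel fst = \<mu>" "distr \<gamma> borel snd = \<nu>"
    unfolding \<gamma>_def using assms by (subst distr_distr; simp add: borel_prod[symmetric] comp_def)+
  then have "\<gamma> \<in> couplings \<mu> \<nu>" by (simp add: couplings_def \<gamma>_def)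
  then have "(INF \<gamma>\<in>couplings \<mu> \<nu>. \<integral>\<^sup>+ (x, y). ennreal ((norm (x - y))\<^sup>2) \<partial>\<gamma>)
      \<le> (\<integral>\<^sup>+ (x, y). ennreal ((norm (x - y))\<^sup>2) \<partial>\<gamma>)" by (rule INF_lower)
  also have "\<dots> = (\<integral>\<^sup>+ z. ennreal ((norm (X z - Y z))\<^sup>2) \<partial>M)"
  proof -
    have "(\<lambda>(x, y). ennreal ((norm (x - y))\<^sup>2)) \<in> borel_measurable (borel :: ('a \<times> 'a) measure)"
      unfolding borel_prod[symmetric] by measurable
    then show ?thesis unfolding \<gamma>_def by (subst nn_integral_distr) auto
  qed
  finally have "(INF \<gamma>\<in>couplings \<mu> \<nu>. \<integral>\<^sup>+ (x, y). ennreal ((norm (x - y))\<^sup>2) \<partial>\<gamma>) \<le> ennreal (A\<^sup>2)"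
    using cost by simp
  then have "enn2real (INF \<gamma>\<in>couplings \<mu> \<nu>. \<integral>\<^sup>+ (x, y). ennreal ((norm (x - y))\<^sup>2) \<partial>\<gamma>) \<le> A\<^sup>2"
    by (simp add: enn2real_leI)
  then show ?thesis unfolding W2_def using \<open>0 \<le> A\<close> by (simp add: real_le_lsqrt)
qed

lemma couplings_product:
  assumes "\<mu> \<in> P2" "\<nu> \<in> P2"
  shows "\<mu> \<Otimes>\<^sub>M \<nu> \<in> couplings \<mu> \<nu>"
    "(\<integral>\<^sup>+ (x, y). ennreal ((norm (x - y))\<^sup>2) \<partial>(\<mu> \<Otimes>\<^sub>M \<nu>)) < \<infinity>"
proof -
  interpret M: prob_space \<mu> using P2D[OF assms(1)] by simp
  interpret N: prob_space \<nu> using P2D[OF assms(2)] by simp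
  interpret pair_prob_space \<mu> \<nu> ..
  note [measurable_cong] = P2D(2)[OF assms(1)] P2D(2)[OF assms(2)]
  have s: "sets (\<mu> \<Otimes>\<^sub>M \<nu>) = sets borel"
    using P2D(2)[OF assms(1)] P2D(2)[OF assms(2)] by (subst borel_prod[symmetric]) (rule sets_pair_measure_cong)
  have "distr (\<mu> \<Otimes>\<^sub>M \<nu>) \<mu> fst = \<mu>" by (simp add: N.distr_pair_fst)
  moreover have "distr (\<mu> \<Otimes>\<^sub>M \<nu>) \<nu> snd = \<nu>" 
  proof (rule measure_eqI)
    fix A assume "A \<in> sets (distr (\<mu> \<Otimes>\<^sub>M \<nu>) \<nu> snd)"
    then have A: "A \<in> sets \<nu>" by simp
    have "emeasure (distr (\<mu> \<Otimes>\<^sub>M \<nu>) \<nu> snd) A = emeasure (\<mu> \<Otimes>\<^sub>M \<nu>) (space \<mu> \<times> A)"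
      using A sets.sets_into_space[OF A]
      by (subst emeasure_distr) (auto intro!: arg_cong2[where f=emeasure] simp: space_pair_measure)
    then show "emeasure (distr (\<mu> \<Otimes>\<^sub>M \<nu>) \<nu> snd) A = emeasure \<nu> A"
      using A by (simp add: N.emeasure_pair_measure_Times M.emeasure_space_1)
  qed simp
  moreover have "distr (\<mu> \<Otimes>\<^sub>M \<nu>) borel fst = distr (\<mu> \<Otimes>\<^sub>M \<nu>) \<mu> fst"
    "distr (\<mu> \<Otimes>\<^sub>M \<nu>) borel snd = distr (\<mu> \<Otimes>\<^sub>M \<nu>) \<nu> snd"
    by (auto intro!: distr_cong simp: P2D(2)[OF assms(1)] P2D(2)[OF assms(2)])
  ultimately show "\<mu> \<Otimes>\<^sub>M \<nu> \<in> couplings \<mu> \<nu>" using s by (simp add: couplings_def)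
  have "(norm (x - y))\<^sup>2 \<le> 2 * (norm x)\<^sup>2 + 2 * (norm y)\<^sup>2" for x y :: 'a
  proof -
    have "(norm (x - y))\<^sup>2 \<le> (norm x + norm y)\<^sup>2" by (intro power_mono norm_triangle_ineq4) auto
    also have "\<dots> \<le> 2 * (norm x)\<^sup>2 + 2 * (norm y)\<^sup>2" using sum_squares_bound[of "norm x" "norm y"] by (simp add: power2_sum)
    finally show ?thesis .
  qed
  then have "(\<integral>\<^sup>+ (x, y). ennreal ((norm (x - y))\<^sup>2) \<partial>(\<mu> \<Otimes>\<^sub>M \<nu>))
      \<le> (\<integral>\<^sup>+ z. 2 * ennreal ((norm (fst z))\<^sup>2) + 2 * ennreal ((norm (snd z))\<^sup>2) \<partial>(\<mu> \<Otimes>\<^sub>M \<nu>))"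
    by (intro nn_integral_mono) (auto simp: ennreal_mult'[symmetric] ennreal_plus[symmetric] simp del: ennreal_plus intro!: ennreal_leI
       simp flip: ennreal_numeral)
  also have "\<dots> = 2 * (\<integral>\<^sup>+ z. ennreal ((norm (fst z))\<^sup>2) \<partial>(\<mu> \<Otimes>\<^sub>M \<nu>)) + 2 * (\<integral>\<^sup>+ z. ennreal ((norm (snd z))\<^sup>2) \<partial>(\<mu> \<Otimes>\<^sub>M \<nu>))"
    by (subst nn_integral_add; simp add: nn_integral_cmult)
  also have "(\<integral>\<^sup>+ z. ennreal ((norm (fst z))\<^sup>2) \<partial>(\<mu> \<Otimes>\<^sub>M \<nu>)) = (\<integral>\<^sup>+ x. ennreal ((norm x)\<^sup>2) \<partial>\<mu>)"
    by (subst N.nn_integral_fst[symmetric]) (auto simp: N.emeasure_space_1)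
  also have "(\<integral>\<^sup>+ z. ennreal ((norm (snd z))\<^sup>2) \<partial>(\<mu> \<Otimes>\<^sub>M \<nu>)) = (\<integral>\<^sup>+ x. ennreal ((norm x)\<^sup>2) \<partial>\<nu>)"
    by (subst nn_integral_snd[symmetric]) (auto simp: M.emeasure_space_1)
  finally show "(\<integral>\<^sup>+ (x, y). ennreal ((norm (x - y))\<^sup>2) \<partial>(\<mu> \<Otimes>\<^sub>M \<nu>)) < \<infinity>"
    using P2D(4)[OF assms(1)] P2D(4)[OF assms(2)]
    by (auto simp: ennreal_mult_less_top ennreal_add_less_top order_le_less_trans less_top)
qed

lemma W2_less_obtain_coupling:
  assumes "\<mu> \<in> P2" "\<nu> \<in> P2" and less: "W2 \<mu> \<nu> < A"
  obtains \<gamma> where "\<gamma> \<in> couplings \<mu> \<nu>"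
    "(\<integral>\<^sup>+ z. ennreal ((norm (fst z - snd z))\<^sup>2) \<partial>\<gamma>) \<le> ennreal (A\<^sup>2)"
proof -
  define c where "c = (INF \<gamma>\<in>couplings \<mu> \<nu>. \<integral>\<^sup>+ (x, y). ennreal ((norm (x - y))\<^sup>2) \<partial>\<gamma>)"
  have "c \<le> (\<integral>\<^sup>+ (x, y). ennreal ((norm (x - y))\<^sup>2) \<partial>(\<mu> \<Otimes>\<^sub>M \<nu>))"
    unfolding c_def by (rule INF_lower) (rule couplings_product[OF assms(1,2)])
  then have fin: "c < top" using couplings_product(2)[OF assms(1,2)] by auto
  have "sqrt (enn2real c) < A" using less by (simp add: W2_def c_def)
  then have "enn2real c < A\<^sup>2"
    by (metis enn2real_nonneg not_less real_sqrt_ge_abs1 real_sqrt_less_iff real_sqrt_unique abs_ge_self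
        order.strict_trans2 power2_abs real_sqrt_abs real_sqrt_le_mono)
  then have "c < ennreal (A\<^sup>2)" using fin
    by (metis enn2real_nonneg ennreal_enn2real ennreal_lessI order_le_less_trans)
  then obtain \<gamma> where \<gamma>: "\<gamma> \<in> couplings \<mu> \<nu>"
    and "(\<integral>\<^sup>+ (x, y). ennreal ((norm (x - y))\<^sup>2) \<partial>\<gamma>) < ennreal (A\<^sup>2)"
    unfolding c_def INF_less_iff by blast
  from less_imp_le[OF this(2), unfolded case_prod_beta] \<gamma> show ?thesis using that by blast
qed

lemma couplingsD:
  assumes "\<gamma> \<in> couplings \<mu> \<nu>" "\<mu> \<in> P2"
  shows "sets \<gamma> = sets borel" "distr \<gamma> borel fst = \<mu>" "distr \<gamma> borel snd = \<nu>" "prob_space \<gamma>"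
    "fst \<in> borel_measurable \<gamma>" "snd \<in> borel_measurable \<gamma>"
proof -
  show *: "sets \<gamma> = sets borel" "distr \<gamma> borel fst = \<mu>" "distr \<gamma> borel snd = \<nu>"
    using assms by (auto simp: couplings_def)
  show m: "fst \<in> borel_measurable \<gamma>" "snd \<in> borel_measurable \<gamma>"
    using *(1) by (auto simp: borel_prod[symmetric] cong: measurable_cong_sets)
  show "prob_space \<gamma>"
  proof (rule prob_spaceI)
    have "emeasure \<gamma> (space \<gamma>) = emeasure (distr \<gamma> borel fst) UNIV"
      using m by (subst emeasure_distr) auto
    also have "\<dots> = 1" using prob_space.emeasure_space_1[OF P2D(1)[OF assms(2)]] *(2) P2D(3)[OF assms(2)] by simp
    finally show "emeasure \<gamma> (space \<gamma>) = 1" .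
  qed
qed

lemma weighted_square_sum:
  fixes a b A B :: real
  assumes "A > 0" "B > 0"
  shows "(a + b)\<^sup>2 \<le> (A + B) * (a\<^sup>2 / A + b\<^sup>2 / B)"
proof -
  have "(A + B) * (a\<^sup>2 / A + b\<^sup>2 / B) - (a + b)\<^sup>2 = (a * B - b * A)\<^sup>2 / (A * B)"
    using assms by (simp add: field_simps power2_eq_square)
  also have "\<dots> \<ge> 0" using assms by simp
  finally show ?thesis by simp
qed

text \<open>Minkowski's inequality in \<open>L\<^sup>2\<close>, in the form in which upper bounds \<open>A\<close> and \<open>B\<close> on the norms
  are at hand.  It follows from the pointwise weighted inequality with weights adapted to \<open>A\<close>
  and \<open>B\<close>, so that infinite integrals need no special treatment.\<close>

lemma nn_integral_square_sum_le:
  fixes a b c :: "'b \<Rightarrow> real"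
  assumes [measurable]: "a \<in> borel_measurable M" "b \<in> borel_measurable M"
    and AB: "A > 0" "B > 0"
    and c: "AE z in M. 0 \<le> c z \<and> c z \<le> a z + b z"
    and "(\<integral>\<^sup>+ z. ennreal ((a z)\<^sup>2) \<partial>M) \<le> ennreal (A\<^sup>2)"
    and "(\<integral>\<^sup>+ z. ennreal ((b z)\<^sup>2) \<partial>M) \<le> ennreal (B\<^sup>2)"
  shows "(\<integral>\<^sup>+ z. ennreal ((c z)\<^sup>2) \<partial>M) \<le> ennreal ((A + B)\<^sup>2)"
proof -
  have "(\<integral>\<^sup>+ z. ennreal ((c z)\<^sup>2) \<partial>M)
      \<le> (\<integral>\<^sup>+ z. ennreal ((A + B) / A) * ennreal ((a z)\<^sup>2) + ennreal ((A + B) / B) * ennreal ((b z)\<^sup>2) \<partial>M)"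
  proof (rule nn_integral_mono_AE, use c in eventually_elim)
    case (elim z)
    have "(c z)\<^sup>2 \<le> (a z + b z)\<^sup>2" using elim by (intro power_mono) auto
    also have "\<dots> \<le> (A + B) / A * (a z)\<^sup>2 + (A + B) / B * (b z)\<^sup>2"
      using weighted_square_sum[OF AB, of "a z" "b z"] by (simp add: field_simps)
    finally show ?case using AB
      by (auto simp: ennreal_mult'[symmetric] ennreal_plus[symmetric] simp del: ennreal_plus intro!: ennreal_leI)
  qed
  also have "\<dots> = ennreal ((A + B) / A) * (\<integral>\<^sup>+ z. ennreal ((a z)\<^sup>2) \<partial>M) + ennreal ((A + B) / B) * (\<integral>\<^sup>+ z. ennreal ((b z)\<^sup>2) \<partial>M)"
    by (subst nn_integral_add; simp add: nn_integral_cmult)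
  also have "\<dots> \<le> ennreal ((A + B) / A) * ennreal (A\<^sup>2) + ennreal ((A + B) / B) * ennreal (B\<^sup>2)"
    by (intro add_mono mult_left_mono assms) auto
  also have "\<dots> = ennreal ((A + B)\<^sup>2)"
    using AB by (simp add: ennreal_mult'[symmetric] ennreal_plus[symmetric] del: ennreal_plus) (simp add: field_simps power2_eq_square)
  finally show ?thesis .
qed

text \<open>An almost optimal coupling of the law of \<open>f\<close> with \<open>\<sigma>\<close> can be lifted to a coupling of the
  underlying measure \<open>M\<close> with \<open>\<sigma>\<close>.  The displacement caused by approximate gluing is absorbed by
  the strict inequality for \<open>A\<close>.  Both the triangle inequality (with \<open>M\<close> a coupling) and the
  semiconcavity along \<open>exp_push\<close> (with \<open>M\<close> a measure on the tangent bundle) use it.\<close>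

lemma lift_coupling:
  fixes f :: "'b \<Rightarrow> 'a::{real_inner, polish_space}"
  assumes "prob_space M" and f[measurable]: "f \<in> borel_measurable M"
    and P: "distr M borel f \<in> P2" "\<sigma> \<in> P2" and A: "W2 (distr M borel f) \<sigma> < A"
  obtains \<Theta> where "sets \<Theta> = sets (M \<Otimes>\<^sub>M borel)" "distr \<Theta> M fst = M" "distr \<Theta> borel snd = \<sigma>"
    "(\<integral>\<^sup>+ z. ennreal ((norm (f (fst z) - snd z))\<^sup>2) \<partial>\<Theta>) \<le> ennreal (A\<^sup>2)"
proof -
  obtain B where B: "W2 (distr M borel f) \<sigma> < B" "B < A" using dense[OF A] by blast
  have "B > 0" using B W2_nonneg[of "distr M borel f" \<sigma>] by linarith
  obtain \<gamma> where \<gamma>: "\<gamma> \<in> couplings (distr M borel f) \<sigma>"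
    and cost: "(\<integral>\<^sup>+ z. ennreal ((norm (fst z - snd z))\<^sup>2) \<partial>\<gamma>) \<le> ennreal (B\<^sup>2)"
    using W2_less_obtain_coupling[OF P B(1)] by blast
  note g = couplingsD[OF \<gamma> P(1)]
  note [measurable] = g(5,6)
  obtain Q where Q: "sets Q = sets (M \<Otimes>\<^sub>M \<gamma>)" "distr Q M fst = M" "distr Q \<gamma> snd = \<gamma>"
    and near: "AE z in Q. dist (f (fst z)) (fst (snd z)) \<le> A - B"
    using approximate_gluing[OF assms(1) g(4) f g(5), of "A - B"] g(2) B(2) by auto
  note [measurable_cong] = Q(1)
  have pQ: "prob_space Q"
    using assms(1) prob_space_distrD[of fst Q M] Q(2) by (simp add: measurable_cong_sets[OF Q(1) refl])
  define \<Theta> where "\<Theta> = distr Q (M \<Otimes>\<^sub>M borel) (\<lambda>z. (fst z, snd (snd z)))"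
  have [measurable]: "(\<lambda>z. (fst z, snd (snd z))) \<in> measurable Q (M \<Otimes>\<^sub>M borel)" by measurable
  have "distr \<Theta> M fst = M" unfolding \<Theta>_def using Q(2) by (subst distr_distr; simp add: comp_def)
  moreover have "distr \<Theta> borel snd = \<sigma>"
  proof -
    have "distr \<Theta> borel snd = distr (distr Q \<gamma> snd) borel snd"
      unfolding \<Theta>_def by (subst distr_distr; simp add: distr_distr comp_def)
    then show ?thesis using Q(3) g(3) by simp
  qed
  moreover have "(\<integral>\<^sup>+ z. ennreal ((norm (f (fst z) - snd z))\<^sup>2) \<partial>\<Theta>) \<le> ennreal (A\<^sup>2)"
  proof -
    have "(\<integral>\<^sup>+ z. ennreal ((norm (f (fst z) - snd z))\<^sup>2) \<partial>\<Theta>)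
        = (\<integral>\<^sup>+ z. ennreal ((norm (f (fst z) - snd (snd z)))\<^sup>2) \<partial>Q)"
      unfolding \<Theta>_def by (subst nn_integral_distr) auto
    also have "\<dots> \<le> ennreal (((A - B) + B)\<^sup>2)"
    proof (rule nn_integral_square_sum_le[where a="\<lambda>_. A - B" and b="\<lambda>z. norm (fst (snd z) - snd (snd z))"])
      show "AE z in Q. 0 \<le> norm (f (fst z) - snd (snd z)) \<and>
          norm (f (fst z) - snd (snd z)) \<le> A - B + norm (fst (snd z) - snd (snd z))"
        using near
      proof eventually_elim
        case (elim z)
        then show ?case
          using norm_triangle_ineq[of "f (fst z) - fst (snd z)" "fst (snd z) - snd (snd z)"]
          by (simp add: dist_norm)
      qed
      show "(\<integral>\<^sup>+ z. ennreal ((A - B)\<^sup>2) \<partial>Q) \<le> ennreal ((A - B)\<^sup>2)"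
        using prob_space.emeasure_space_1[OF pQ] by simp
      have "(\<integral>\<^sup>+ z. ennreal ((norm (fst (snd z) - snd (snd z)))\<^sup>2) \<partial>Q)
          = (\<integral>\<^sup>+ z. ennreal ((norm (fst z - snd z))\<^sup>2) \<partial>distr Q \<gamma> snd)"
        by (subst nn_integral_distr) auto
      then show "(\<integral>\<^sup>+ z. ennreal ((norm (fst (snd z) - snd (snd z)))\<^sup>2) \<partial>Q) \<le> ennreal (B\<^sup>2)"
        using cost Q(3) by simp
    qed (use B \<open>B > 0\<close> in auto)
    finally show ?thesis by simp
  qed
  ultimately show ?thesis using that[of \<Theta>] by (simp add: \<Theta>_def)
qed

lemma W2_triangle:
  assumes P: "\<mu> \<in> P2" "\<nu> \<in> P2" "\<sigma> \<in> P2"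
  shows "W2 \<mu> \<sigma> \<le> W2 \<mu> \<nu> + W2 \<nu> \<sigma>"
proof (rule field_le_epsilon)
  fix e :: real assume "e > 0"
  define A where "A = W2 \<mu> \<nu> + e / 2"
  define B where "B = W2 \<nu> \<sigma> + e / 2"
  have AB: "A > 0" "B > 0" "W2 \<mu> \<nu> < A" "W2 \<nu> \<sigma> < B"
    using \<open>e > 0\<close> W2_nonneg[of \<mu> \<nu>] W2_nonneg[of \<nu> \<sigma>] by (auto simp: A_def B_def)
  obtain \<gamma> where \<gamma>: "\<gamma> \<in> couplings \<mu> \<nu>"
    and cost: "(\<integral>\<^sup>+ z. ennreal ((norm (fst z - snd z))\<^sup>2) \<partial>\<gamma>) \<le> ennreal (A\<^sup>2)"
    using W2_less_obtain_coupling[OF P(1,2) AB(3)] by blast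
  note g = couplingsD[OF \<gamma> P(1)]
  note [measurable] = g(5,6)
  obtain \<Theta> where T: "sets \<Theta> = sets (\<gamma> \<Otimes>\<^sub>M borel)" "distr \<Theta> \<gamma> fst = \<gamma>" "distr \<Theta> borel snd = \<sigma>"
    and cost2: "(\<integral>\<^sup>+ z. ennreal ((norm (snd (fst z) - snd z))\<^sup>2) \<partial>\<Theta>) \<le> ennreal (B\<^sup>2)"
    using lift_coupling[OF g(4,6), of \<sigma> B] g(3) P AB by auto
  note [measurable_cong] = T(1)
  have "W2 \<mu> \<sigma> \<le> A + B"
  proof (rule W2_le_if_common_source[where M=\<Theta> and X="\<lambda>z. fst (fst z)" and Y=snd])
    have "distr \<Theta> borel (\<lambda>z. fst (fst z)) = distr (distr \<Theta> \<gamma> fst) borel fst"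
      by (subst distr_distr; simp add: comp_def)
    then show "distr \<Theta> borel (\<lambda>z. fst (fst z)) = \<mu>" using T(2) g(2) by simp
    show "(\<integral>\<^sup>+ z. ennreal ((norm (fst (fst z) - snd z))\<^sup>2) \<partial>\<Theta>) \<le> ennreal ((A + B)\<^sup>2)"
    proof (rule nn_integral_square_sum_le[OF _ _ AB(1,2) _ _ cost2])
      have "(\<integral>\<^sup>+ z. ennreal ((norm (fst (fst z) - snd (fst z)))\<^sup>2) \<partial>\<Theta>)
          = (\<integral>\<^sup>+ z. ennreal ((norm (fst z - snd z))\<^sup>2) \<partial>distr \<Theta> \<gamma> fst)"
        by (subst nn_integral_distr) auto
      then show "(\<integral>\<^sup>+ z. ennreal ((norm (fst (fst z) - snd (fst z)))\<^sup>2) \<partial>\<Theta>) \<le> ennreal (A\<^sup>2)"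
        using cost T(2) by simp
      have "norm (fst (fst z) - snd z) \<le> norm (fst (fst z) - snd (fst z)) + norm (snd (fst z) - snd z)"
        for z :: "('a \<times> 'a) \<times> 'a"
        using norm_triangle_ineq[of "fst (fst z) - snd (fst z)" "snd (fst z) - snd z"] by simp
      then show "AE z in \<Theta>. 0 \<le> norm (fst (fst z) - snd z) \<and> norm (fst (fst z) - snd z)
          \<le> norm (fst (fst z) - snd (fst z)) + norm (snd (fst z) - snd z)" by simp
    qed measurable
  qed (use T AB in auto)
  then show "W2 \<mu> \<sigma> \<le> W2 \<mu> \<nu> + W2 \<nu> \<sigma> + e" by (simp add: A_def B_def)
qed

lemma W2_commute:
  assumes "\<mu> \<in> P2" "\<nu> \<in> P2"
  shows "W2 \<mu> \<nu> = W2 \<nu> \<mu>"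
proof -
  have *: "W2 \<nu> \<mu> \<le> W2 \<mu> \<nu>" if P: "\<mu> \<in> P2" "\<nu> \<in> P2" for \<mu> \<nu> :: "'a measure"
  proof (rule dense_ge)
    fix A assume A: "W2 \<mu> \<nu> < A"
    obtain \<gamma> where \<gamma>: "\<gamma> \<in> couplings \<mu> \<nu>"
      and cost: "(\<integral>\<^sup>+ z. ennreal ((norm (fst z - snd z))\<^sup>2) \<partial>\<gamma>) \<le> ennreal (A\<^sup>2)"
      using W2_less_obtain_coupling[OF P A] by blast
    note g = couplingsD[OF \<gamma> P(1)]
    show "W2 \<nu> \<mu> \<le> A"
      using W2_le_if_common_source[OF g(6,5,3,2)] cost A W2_nonneg[of \<mu> \<nu>] by (simp add: norm_minus_commute)
  qed
  show ?thesis using *[of \<mu> \<nu>] *[of \<nu> \<mu>] assms by simp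
qed

lemma W2_self:
  assumes "\<mu> \<in> P2"
  shows "W2 \<mu> \<mu> = 0"
proof -
  have "distr \<mu> borel (\<lambda>x. x) = \<mu>" using distr_id2[OF P2D(2)[OF assms, symmetric]] by (simp add: id_def)
  then have "W2 \<mu> \<mu> \<le> 0"
    by (intro W2_le_if_common_source[where X="\<lambda>x. x" and Y="\<lambda>x. x" and M=\<mu>])
      (auto simp: measurable_cong_sets[OF P2D(2)[OF assms] refl])
  then show ?thesis using W2_nonneg[of \<mu> \<mu>] by simp
qed

section \<open>Separation of measures and semiconcavity along displacements\<close>

lemma W2_square_le_if_common_source:
  fixes X Y :: "'b \<Rightarrow> 'a::{real_inner, polish_space}"
  assumes "X \<in> borel_measurable M" "Y \<in> borel_measurable M"
    and "distr M borel X = \<mu>" "distr M borel Y = \<nu>"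
  shows "ennreal ((W2 \<mu> \<nu>)\<^sup>2) \<le> (\<integral>\<^sup>+ z. ennreal ((norm (X z - Y z))\<^sup>2) \<partial>M)"
proof (cases "\<integral>\<^sup>+ z. ennreal ((norm (X z - Y z))\<^sup>2) \<partial>M")
  case (real r)
  then have "W2 \<mu> \<nu> \<le> sqrt r" using W2_le_if_common_source[OF assms, of "sqrt r"] by simp
  then have "(W2 \<mu> \<nu>)\<^sup>2 \<le> r" using power_mono[OF _ W2_nonneg, of \<mu> \<nu> "sqrt r" 2] \<open>0 \<le> r\<close> by simp
  then show ?thesis using real by (simp add: ennreal_leI)
qed simp

text \<open>By Chebyshev's inequality, a coupling of cost at most \<open>d ^ 4\<close> moves at most the mass \<open>d\<^sup>2\<close>
  farther than \<open>d\<close>.  Hence \<open>\<mu> A\<close> is at most \<open>d\<^sup>2\<close> plus the \<open>\<nu>\<close>-measure of a closed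
  neighbourhood of \<open>A\<close>, and these neighbourhoods shrink to \<open>A\<close>.\<close>

lemma W2_zero_measure_closed_le:
  assumes P: "\<mu> \<in> P2" "\<nu> \<in> P2" and 0: "W2 \<mu> \<nu> = 0" and A: "closed A" "A \<noteq> {}"
  shows "measure \<mu> A \<le> measure \<nu> A"
proof -
  interpret M: prob_space \<mu> using P2D[OF P(1)] by simp
  interpret N: prob_space \<nu> using P2D[OF P(2)] by simp
  define K where "K n = {y. infdist y A \<le> 1 / Suc n}" for n
  have K: "closed (K n)" for n unfolding K_def by (intro closed_Collect_le continuous_intros)
  have "measure \<mu> A \<le> measure \<nu> (K n) + (1 / Suc n)\<^sup>2" for n
  proof -
    define d :: real where "d = 1 / Suc n"
    have d: "d > 0" by (simp add: d_def)
    obtain \<gamma> where \<gamma>: "\<gamma> \<in> couplings \<mu> \<nu>"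
      and cost: "(\<integral>\<^sup>+ z. ennreal ((norm (fst z - snd z))\<^sup>2) \<partial>\<gamma>) \<le> ennreal ((d\<^sup>2)\<^sup>2)"
      using W2_less_obtain_coupling[OF P, of "d\<^sup>2"] 0 d by auto
    note g = couplingsD[OF \<gamma> P(1)]
    note [measurable] = g(5,6)
    interpret G: prob_space \<gamma> by (rule g(4))
    have sp: "space \<gamma> = UNIV" using sets_eq_imp_space_eq[OF g(1)] by simp
    have [measurable]: "A \<in> sets borel" "K n \<in> sets borel" using A K by auto
    define B where "B = {z :: 'a \<times> 'a. (norm (fst z - snd z))\<^sup>2 \<ge> d\<^sup>2}"
    have B[measurable]: "B \<in> sets \<gamma>"
    proof -
      have "{z\<in>space \<gamma>. (norm (fst z - snd z))\<^sup>2 \<ge> d\<^sup>2} \<in> sets \<gamma>" by measurable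
      then show ?thesis by (simp add: B_def sp)
    qed
    have "ennreal (d\<^sup>2) * emeasure \<gamma> B = (\<integral>\<^sup>+ z. ennreal (d\<^sup>2) * indicator B z \<partial>\<gamma>)"
      by (simp add: nn_integral_cmult_indicator)
    also have "\<dots> \<le> (\<integral>\<^sup>+ z. ennreal ((norm (fst z - snd z))\<^sup>2) \<partial>\<gamma>)"
      by (intro nn_integral_mono) (auto simp: B_def indicator_def intro!: ennreal_leI)
    also note cost
    also have "ennreal ((d\<^sup>2)\<^sup>2) = ennreal (d\<^sup>2) * ennreal (d\<^sup>2)"
      by (simp add: ennreal_mult[symmetric] power2_eq_square)
    finally have "ennreal (d\<^sup>2) * ennreal (measure \<gamma> B) \<le> ennreal (d\<^sup>2) * ennreal (d\<^sup>2)"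
      by (simp add: G.emeasure_eq_measure)
    then have "d\<^sup>2 * measure \<gamma> B \<le> d\<^sup>2 * d\<^sup>2"
      by (simp add: ennreal_mult[symmetric])
    then have mB: "measure \<gamma> B \<le> d\<^sup>2" by (rule mult_left_le_imp_le) (use d in simp)
    have "measure \<mu> A = measure \<gamma> (fst -` A)"
      using measure_distr[OF g(5), of A] g(2) sp by simp
    also have "\<dots> \<le> measure \<gamma> (snd -` K n \<union> B)"
    proof (rule G.finite_measure_mono)
      show "fst -` A \<subseteq> snd -` K n \<union> B"
      proof
        fix z :: "'a \<times> 'a" assume z: "z \<in> fst -` A"
        show "z \<in> snd -` K n \<union> B"
        proof (cases "z \<in> B")
          case False
          then have "(norm (fst z - snd z))\<^sup>2 < d\<^sup>2" by (simp add: B_def)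
          then have "norm (fst z - snd z) < d" using power2_less_imp_less d by fastforce
          moreover have "infdist (snd z) A \<le> dist (snd z) (fst z)" using z by (intro infdist_le) auto
          ultimately show ?thesis by (auto simp: K_def d_def dist_norm norm_minus_commute)
        qed simp
      qed
      have "snd -` K n \<inter> space \<gamma> \<in> sets \<gamma>" by measurable
      then show "snd -` K n \<union> B \<in> sets \<gamma>" using B sp by auto
    qed
    also have "\<dots> \<le> measure \<gamma> (snd -` K n) + measure \<gamma> B"
      using measurable_sets[OF g(6), of "K n"] sp B by (intro measure_Un_le) auto
    also have "measure \<gamma> (snd -` K n) = measure \<nu> (K n)"
      using measure_distr[OF g(6), of "K n"] g(3) sp by simp
    finally show ?thesis using mB by (simp add: d_def)
  qed
  moreover have "(\<lambda>n. measure \<nu> (K n)) \<longlonglongrightarrow> measure \<nu> (\<Inter>n. K n)"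
  proof (rule N.finite_Lim_measure_decseq)
    show "range K \<subseteq> N.events" using K P2D(2)[OF P(2)] by auto
    have "1 / real (Suc n) \<le> 1 / real (Suc m)" if "m \<le> n" for m n using that by (simp add: frac_le)
    then show "decseq K" unfolding K_def decseq_def by (auto intro: order_trans)
  qed
  then have "(\<lambda>n. measure \<nu> (K n) + (1 / Suc n)\<^sup>2) \<longlonglongrightarrow> measure \<nu> (\<Inter>n. K n) + 0\<^sup>2"
    by (intro tendsto_intros LIMSEQ_Suc[OF lim_1_over_n])
  ultimately have "measure \<mu> A \<le> measure \<nu> (\<Inter>n. K n) + 0\<^sup>2"
    by (intro LIMSEQ_le_const) auto
  also have "(\<Inter>n. K n) = A"
  proof
    show "(\<Inter>n. K n) \<subseteq> A"
    proof
      fix y assume "y \<in> (\<Inter>n. K n)"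
      then have "infdist y A \<le> 1 / Suc n" for n by (auto simp: K_def)
      then have "infdist y A \<le> 0"
        using LIMSEQ_le_const[OF LIMSEQ_Suc[OF lim_1_over_n]] by blast
      then show "y \<in> A" using in_closed_iff_infdist_zero[OF A, of y] infdist_nonneg[of y A] by simp
    qed
    show "A \<subseteq> (\<Inter>n. K n)" by (auto simp: K_def)
  qed
  finally show ?thesis by simp
qed

lemma W2_zero_imp_eq:
  assumes P: "\<mu> \<in> P2" "\<nu> \<in> P2" and 0: "W2 \<mu> \<nu> = 0"
  shows "\<mu> = \<nu>"
proof -
  interpret M: prob_space \<mu> using P2D[OF P(1)] by simp
  interpret N: prob_space \<nu> using P2D[OF P(2)] by simp
  have sym0: "W2 \<nu> \<mu> = 0" using 0 W2_commute[OF P] by simp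
  have eq: "emeasure \<mu> A = emeasure \<nu> A" if "closed A" for A
  proof (cases "A = {}")
    case False
    then have "measure \<mu> A = measure \<nu> A"
      using W2_zero_measure_closed_le[OF P 0 that] W2_zero_measure_closed_le[OF P(2,1) sym0 that] by simp
    then show ?thesis by (simp add: M.emeasure_eq_measure N.emeasure_eq_measure)
  qed simp
  show ?thesis
  proof (rule measure_eqI_generator_eq[where \<Omega>=UNIV and E="{S. closed S}" and A="\<lambda>_. UNIV"])
    show "sets \<mu> = sigma_sets UNIV {S. closed S}" "sets \<nu> = sigma_sets UNIV {S. closed S}"
      using P2D(2)[OF P(1)] P2D(2)[OF P(2)] by (simp_all add: borel_eq_closed)
  qed (use eq in \<open>auto simp: Int_stable_def\<close>)
qed

lemma P2TD:
  assumes "\<Phi> \<in> P2T"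
  shows "prob_space \<Phi>" "sets \<Phi> = sets borel"
    "fst \<in> borel_measurable \<Phi>" "snd \<in> borel_measurable \<Phi>"
    "(\<integral>\<^sup>+ z. ennreal ((norm (fst z))\<^sup>2) \<partial>\<Phi>) < \<infinity>"
    "(\<integral>\<^sup>+ z. ennreal ((norm (snd z))\<^sup>2) \<partial>\<Phi>) = ennreal ((speed \<Phi>)\<^sup>2)"
proof -
  show *: "prob_space \<Phi>" "sets \<Phi> = sets borel" using assms by (auto simp: P2T_def)
  have fin: "(\<integral>\<^sup>+ z. ennreal ((norm (fst z))\<^sup>2 + (norm (snd z))\<^sup>2) \<partial>\<Phi>) < \<infinity>"
    using assms by (simp add: P2T_def case_prod_unfold)
  show m[measurable]: "fst \<in> borel_measurable \<Phi>" "snd \<in> borel_measurable \<Phi>"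
    using *(2) by (auto simp: borel_prod[symmetric] cong: measurable_cong_sets)
  show "(\<integral>\<^sup>+ z. ennreal ((norm (fst z))\<^sup>2) \<partial>\<Phi>) < \<infinity>"
    by (rule order.strict_trans1[OF _ fin]) (auto intro!: nn_integral_mono ennreal_leI)
  have v: "(\<integral>\<^sup>+ z. ennreal ((norm (snd z))\<^sup>2) \<partial>\<Phi>) < \<infinity>"
    by (rule order.strict_trans1[OF _ fin]) (auto intro!: nn_integral_mono ennreal_leI)
  have "integrable \<Phi> (\<lambda>z. (norm (snd z))\<^sup>2)" using v by (intro integrableI_nonneg) auto
  then have "(\<integral>\<^sup>+ z. ennreal ((norm (snd z))\<^sup>2) \<partial>\<Phi>) = ennreal (\<integral>z. (norm (snd z))\<^sup>2 \<partial>\<Phi>)"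
    by (intro nn_integral_eq_integral) auto
  also have "(\<integral>z. (norm (snd z))\<^sup>2 \<partial>\<Phi>) = (speed \<Phi>)\<^sup>2"
    unfolding speed_def by (simp add: case_prod_unfold)
  finally show "(\<integral>\<^sup>+ z. ennreal ((norm (snd z))\<^sup>2) \<partial>\<Phi>) = ennreal ((speed \<Phi>)\<^sup>2)" .
qed

lemma speed_nonneg: "0 \<le> speed \<Phi>"
  by (simp add: speed_def case_prod_unfold)

lemma exp_push_eq: "exp_push s \<Phi> = distr \<Phi> borel (\<lambda>z. fst z + s *\<^sub>R snd z)"
  by (simp add: exp_push_def case_prod_unfold)

lemma base_eq_exp_push_0: "base \<Phi> = exp_push 0 \<Phi>"
  by (simp add: base_def exp_push_eq)

lemma measurable_exp:
  assumes "\<Phi> \<in> P2T" shows "(\<lambda>z. fst z + s *\<^sub>R snd z) \<in> borel_measurable \<Phi>"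
  using P2TD(3,4)[OF assms] by measurable

lemma exp_push_in_P2:
  assumes \<Phi>: "\<Phi> \<in> P2T" shows "exp_push s \<Phi> \<in> P2"
proof -
  note [measurable] = P2TD(3,4)[OF \<Phi>] measurable_exp[OF \<Phi>]
  obtain a where a: "0 \<le> a" "(\<integral>\<^sup>+ z. ennreal ((norm (fst z))\<^sup>2) \<partial>\<Phi>) = ennreal a"
    using P2TD(5)[OF \<Phi>] by (cases "\<integral>\<^sup>+ z. ennreal ((norm (fst z))\<^sup>2) \<partial>\<Phi>") auto
  define A where "A = sqrt a + 1"
  define B where "B = \<bar>s\<bar> * speed \<Phi> + 1"
  have AB: "A > 0" "B > 0" using a speed_nonneg[of \<Phi>] by (auto simp: A_def B_def intro!: add_nonneg_pos)
  have "(\<integral>\<^sup>+ z. ennreal ((norm (fst z + s *\<^sub>R snd z))\<^sup>2) \<partial>\<Phi>) \<le> ennreal ((A + B)\<^sup>2)"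
  proof (rule nn_integral_square_sum_le[OF _ _ AB, where a="\<lambda>z. norm (fst z)" and b="\<lambda>z. \<bar>s\<bar> * norm (snd z)"])
    show "(\<integral>\<^sup>+ z. ennreal ((norm (fst z))\<^sup>2) \<partial>\<Phi>) \<le> ennreal (A\<^sup>2)"
      using a by (auto simp: A_def power2_sum intro!: ennreal_leI)
    have "(\<integral>\<^sup>+ z. ennreal ((\<bar>s\<bar> * norm (snd z))\<^sup>2) \<partial>\<Phi>) = ennreal (s\<^sup>2) * (\<integral>\<^sup>+ z. ennreal ((norm (snd z))\<^sup>2) \<partial>\<Phi>)"
      by (subst nn_integral_cmult[symmetric]) (auto simp: power_mult_distrib ennreal_mult')
    also have "\<dots> = ennreal ((\<bar>s\<bar> * speed \<Phi>)\<^sup>2)"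
      by (simp add: P2TD(6)[OF \<Phi>] ennreal_mult'[symmetric] power_mult_distrib)
    also have "\<dots> \<le> ennreal (B\<^sup>2)"
      using speed_nonneg[of \<Phi>] by (intro ennreal_leI power_mono) (auto simp: B_def)
    finally show "(\<integral>\<^sup>+ z. ennreal ((\<bar>s\<bar> * norm (snd z))\<^sup>2) \<partial>\<Phi>) \<le> ennreal (B\<^sup>2)" .
    show "AE z in \<Phi>. 0 \<le> norm (fst z + s *\<^sub>R snd z) \<and> norm (fst z + s *\<^sub>R snd z) \<le> norm (fst z) + \<bar>s\<bar> * norm (snd z)"
      by (auto intro!: AE_I2 order_trans[OF norm_triangle_ineq])
  qed measurable
  then have "(\<integral>\<^sup>+ x. ennreal ((norm x)\<^sup>2) \<partial>exp_push s \<Phi>) < \<infinity>"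
    unfolding exp_push_eq by (subst nn_integral_distr) (auto simp: less_top[symmetric] top_unique)
  then show ?thesis
    unfolding P2_def exp_push_eq using prob_space.prob_space_distr[OF P2TD(1)[OF \<Phi>] measurable_exp[OF \<Phi>]] by auto
qed

lemma base_in_P2: "\<Phi> \<in> P2T \<Longrightarrow> base \<Phi> \<in> P2"
  by (simp add: base_eq_exp_push_0 exp_push_in_P2)

lemma W2_exp_push_Lipschitz:
  assumes \<Phi>: "\<Phi> \<in> P2T"
  shows "W2 (exp_push s \<Phi>) (exp_push t \<Phi>) \<le> \<bar>s - t\<bar> * speed \<Phi>"
proof (rule W2_le_if_common_source[OF measurable_exp[OF \<Phi>] measurable_exp[OF \<Phi>] exp_push_eq[symmetric] exp_push_eq[symmetric]])
  note [measurable] = P2TD(3,4)[OF \<Phi>]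
  have "(\<integral>\<^sup>+ z. ennreal ((norm (fst z + s *\<^sub>R snd z - (fst z + t *\<^sub>R snd z)))\<^sup>2) \<partial>\<Phi>)
      = (\<integral>\<^sup>+ z. ennreal ((s - t)\<^sup>2) * ennreal ((norm (snd z))\<^sup>2) \<partial>\<Phi>)"
    by (intro nn_integral_cong) (simp add: scaleR_diff_left[symmetric] power_mult_distrib ennreal_mult')
  also have "\<dots> = ennreal ((s - t)\<^sup>2) * ennreal ((speed \<Phi>)\<^sup>2)"
    by (simp add: nn_integral_cmult P2TD(6)[OF \<Phi>])
  finally show "(\<integral>\<^sup>+ z. ennreal ((norm (fst z + s *\<^sub>R snd z - (fst z + t *\<^sub>R snd z)))\<^sup>2) \<partial>\<Phi>)
      \<le> ennreal ((\<bar>s - t\<bar> * speed \<Phi>)\<^sup>2)"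
    by (simp add: ennreal_mult'[symmetric] power_mult_distrib)
qed (simp add: speed_nonneg)

lemma norm_square_convex_combination:
  fixes x v y :: "'a::real_inner"
  shows "(1 - \<theta>) * (norm (x - y))\<^sup>2 + \<theta> * (norm (x + s *\<^sub>R v - y))\<^sup>2
       = (norm (x + (\<theta> * s) *\<^sub>R v - y))\<^sup>2 + \<theta> * (1 - \<theta>) * s\<^sup>2 * (norm v)\<^sup>2"
  unfolding power2_norm_eq_inner
  by (simp add: inner_add_left inner_add_right inner_diff_left inner_diff_right inner_commute algebra_simps power2_eq_square)

text \<open>For a fixed coupling of \<open>\<Phi>\<close> with \<open>\<sigma>\<close>, the cost of \<open>exp\<^sup>s \<Phi>\<close> is a quadratic polynomial in \<open>s\<close>
  whose leading coefficient \<open>(speed \<Phi>)\<^sup>2\<close> does not depend on the coupling.  Since couplings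
  of \<open>exp\<^sup>s \<Phi>\<close> with \<open>\<sigma>\<close> lift to couplings of \<open>\<Phi>\<close> with \<open>\<sigma>\<close>, the squared distance minus
  \<open>s\<^sup>2 (speed \<Phi>)\<^sup>2\<close> is an infimum of affine functions, hence concave.\<close>

lemma W2_square_semiconcave:
  assumes \<Phi>: "\<Phi> \<in> P2T" and \<sigma>: "\<sigma> \<in> P2" and \<theta>: "0 \<le> \<theta>" "\<theta> \<le> 1"
  shows "(1 - \<theta>) * (W2 (base \<Phi>) \<sigma>)\<^sup>2 + \<theta> * (W2 (exp_push s \<Phi>) \<sigma>)\<^sup>2
       \<le> (W2 (exp_push (\<theta> * s) \<Phi>) \<sigma>)\<^sup>2 + \<theta> * (1 - \<theta>) * s\<^sup>2 * (speed \<Phi>)\<^sup>2"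
    (is "?L \<le> ?w\<^sup>2 + ?c")
proof (rule ccontr)
  assume "\<not> ?L \<le> ?w\<^sup>2 + ?c"
  \<comment> \<open>Strictness leaves room for an almost optimal coupling of cost below the square of this root.\<close>
  then have "?w < sqrt (?L - ?c)" by (intro real_less_rsqrt) simp
  then obtain A where A: "?w < A" "A < sqrt (?L - ?c)" using dense by blast
  have "A > 0" using A W2_nonneg[of "exp_push (\<theta> * s) \<Phi>" \<sigma>] by linarith
  note [measurable] = P2TD(3,4)[OF \<Phi>]
  obtain \<Theta> where T: "sets \<Theta> = sets (\<Phi> \<Otimes>\<^sub>M borel)" "distr \<Theta> \<Phi> fst = \<Phi>" "distr \<Theta> borel snd = \<sigma>"
    and cost: "(\<integral>\<^sup>+ z. ennreal ((norm (fst (fst z) + (\<theta> * s) *\<^sub>R snd (fst z) - snd z))\<^sup>2) \<partial>\<Theta>) \<le> ennreal (A\<^sup>2)"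
    using lift_coupling[OF P2TD(1)[OF \<Phi>] measurable_exp[OF \<Phi>, of "\<theta> * s"] _ \<sigma>, of A] A(1)
      exp_push_in_P2[OF \<Phi>, of "\<theta> * s"] unfolding exp_push_eq by auto
  note [measurable_cong] = T(1)
  have push: "distr \<Theta> borel (\<lambda>z. fst (fst z) + r *\<^sub>R snd (fst z)) = exp_push r \<Phi>" for r
  proof -
    have "exp_push r \<Phi> = distr (distr \<Theta> \<Phi> fst) borel (\<lambda>z. fst z + r *\<^sub>R snd z)"
      using T(2) by (simp add: exp_push_eq)
    also have "\<dots> = distr \<Theta> borel (\<lambda>z. fst (fst z) + r *\<^sub>R snd (fst z))"
      by (subst distr_distr; simp add: comp_def)
    finally show ?thesis by simp
  qed
  have le: "ennreal ((W2 (exp_push r \<Phi>) \<sigma>)\<^sup>2)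
      \<le> (\<integral>\<^sup>+ z. ennreal ((norm (fst (fst z) + r *\<^sub>R snd (fst z) - snd z))\<^sup>2) \<partial>\<Theta>)" for r
    by (rule W2_square_le_if_common_source[OF _ _ push T(3)]) measurable
  have "ennreal ?L = ennreal (1 - \<theta>) * ennreal ((W2 (exp_push 0 \<Phi>) \<sigma>)\<^sup>2) + ennreal \<theta> * ennreal ((W2 (exp_push s \<Phi>) \<sigma>)\<^sup>2)"
    using \<theta> by (simp add: base_eq_exp_push_0 ennreal_mult)
  also have "\<dots> \<le> ennreal (1 - \<theta>) * (\<integral>\<^sup>+ z. ennreal ((norm (fst (fst z) + 0 *\<^sub>R snd (fst z) - snd z))\<^sup>2) \<partial>\<Theta>)
      + ennreal \<theta> * (\<integral>\<^sup>+ z. ennreal ((norm (fst (fst z) + s *\<^sub>R snd (fst z) - snd z))\<^sup>2) \<partial>\<Theta>)"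
    by (intro add_mono mult_left_mono le) auto
  also have "\<dots> = (\<integral>\<^sup>+ z. ennreal (1 - \<theta>) * ennreal ((norm (fst (fst z) + 0 *\<^sub>R snd (fst z) - snd z))\<^sup>2)
      + ennreal \<theta> * ennreal ((norm (fst (fst z) + s *\<^sub>R snd (fst z) - snd z))\<^sup>2) \<partial>\<Theta>)"
    by (subst nn_integral_add; simp add: nn_integral_cmult)
  also have "\<dots> = (\<integral>\<^sup>+ z. ennreal ((norm (fst (fst z) + (\<theta> * s) *\<^sub>R snd (fst z) - snd z))\<^sup>2)
      + ennreal (\<theta> * (1 - \<theta>) * s\<^sup>2) * ennreal ((norm (snd (fst z)))\<^sup>2) \<partial>\<Theta>)"
  proof (rule nn_integral_cong)
    fix z :: "('a \<times> 'a) \<times> 'a"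
    show "ennreal (1 - \<theta>) * ennreal ((norm (fst (fst z) + 0 *\<^sub>R snd (fst z) - snd z))\<^sup>2)
      + ennreal \<theta> * ennreal ((norm (fst (fst z) + s *\<^sub>R snd (fst z) - snd z))\<^sup>2)
      = ennreal ((norm (fst (fst z) + (\<theta> * s) *\<^sub>R snd (fst z) - snd z))\<^sup>2)
      + ennreal (\<theta> * (1 - \<theta>) * s\<^sup>2) * ennreal ((norm (snd (fst z)))\<^sup>2)"
      using norm_square_convex_combination[of \<theta> "fst (fst z)" "snd z" s "snd (fst z)"] \<theta>
      by (simp add: ennreal_mult[symmetric] ennreal_plus[symmetric] del: ennreal_plus)
  qed
  also have "\<dots> = (\<integral>\<^sup>+ z. ennreal ((norm (fst (fst z) + (\<theta> * s) *\<^sub>R snd (fst z) - snd z))\<^sup>2) \<partial>\<Theta>)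
      + ennreal (\<theta> * (1 - \<theta>) * s\<^sup>2) * (\<integral>\<^sup>+ z. ennreal ((norm (snd (fst z)))\<^sup>2) \<partial>\<Theta>)"
    by (subst nn_integral_add; simp add: nn_integral_cmult)
  also have "(\<integral>\<^sup>+ z. ennreal ((norm (snd (fst z)))\<^sup>2) \<partial>\<Theta>) = (\<integral>\<^sup>+ z. ennreal ((norm (snd z))\<^sup>2) \<partial>distr \<Theta> \<Phi> fst)"
    by (subst nn_integral_distr) auto
  also have "\<dots> = ennreal ((speed \<Phi>)\<^sup>2)" using T(2) P2TD(6)[OF \<Phi>] by simp
  finally have "ennreal ?L \<le> ennreal (A\<^sup>2) + ennreal (\<theta> * (1 - \<theta>) * s\<^sup>2) * ennreal ((speed \<Phi>)\<^sup>2)"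
    using cost by (meson add_right_mono order_trans)
  also have "\<dots> = ennreal (A\<^sup>2 + ?c)"
    using \<theta> by (simp add: ennreal_mult)
  finally have "?L - ?c \<le> A\<^sup>2"
    using \<theta> by (subst (asm) ennreal_le_iff) auto
  then show False using A(2) \<open>A > 0\<close> by (smt (verit) real_le_lsqrt real_sqrt_le_iff real_sqrt_unique)
qed

section \<open>The pairing of a velocity plan with a measure\<close>

lemma W2_quotient_bound:
  assumes \<Phi>: "\<Phi> \<in> P2T" and \<nu>: "\<nu> \<in> P2" and "0 < s"
  shows "\<bar>((W2 (exp_push s \<Phi>) \<nu>)\<^sup>2 - (W2 (base \<Phi>) \<nu>)\<^sup>2) / (2 * s)\<bar>
    \<le> speed \<Phi> * W2 (base \<Phi>) \<nu> + s * (speed \<Phi>)\<^sup>2 / 2"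
proof -
  let ?a = "W2 (exp_push s \<Phi>) \<nu>" and ?b = "W2 (base \<Phi>) \<nu>" and ?v = "speed \<Phi>"
  note P = exp_push_in_P2[OF \<Phi>, of s] base_in_P2[OF \<Phi>] \<nu>
  have "W2 (exp_push s \<Phi>) (base \<Phi>) \<le> s * ?v"
    using W2_exp_push_Lipschitz[OF \<Phi>, of s 0] \<open>0 < s\<close> by (simp add: base_eq_exp_push_0)
  then have d: "\<bar>?a - ?b\<bar> \<le> s * ?v"
    using W2_triangle[OF P(1,2,3)] W2_triangle[OF P(2,1,3)] W2_commute[OF P(1,2)] by linarith
  have "\<bar>?a\<^sup>2 - ?b\<^sup>2\<bar> = \<bar>?a - ?b\<bar> * (?a + ?b)"
    using W2_nonneg[of _ \<nu>] by (simp add: power2_eq_square square_diff_square_factored abs_mult mult.commute)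
  also have "\<dots> \<le> (s * ?v) * (2 * ?b + s * ?v)"
    using d W2_nonneg[of "exp_push s \<Phi>" \<nu>] W2_nonneg[of "base \<Phi>" \<nu>] by (intro mult_mono) auto
  finally have "\<bar>?a\<^sup>2 - ?b\<^sup>2\<bar> \<le> (s * ?v) * (2 * ?b + s * ?v)" .
  then show ?thesis using \<open>0 < s\<close> by (simp add: abs_divide divide_simps power2_eq_square) (simp add: algebra_simps)
qed

text \<open>Concavity says that the corrected difference quotients decrease in the step; this gives both
  the existence of the limit that defines the pairing and one-sided bounds on it.\<close>

lemma W2_quotient_mono:
  assumes \<Phi>: "\<Phi> \<in> P2T" and \<nu>: "\<nu> \<in> P2" and "0 < r" "r \<le> s"
  shows "((W2 (exp_push s \<Phi>) \<nu>)\<^sup>2 - (W2 (base \<Phi>) \<nu>)\<^sup>2) / (2 * s) - s * (speed \<Phi>)\<^sup>2 / 2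
    \<le> ((W2 (exp_push r \<Phi>) \<nu>)\<^sup>2 - (W2 (base \<Phi>) \<nu>)\<^sup>2) / (2 * r) - r * (speed \<Phi>)\<^sup>2 / 2"
proof -
  define \<theta> where "\<theta> = r / s"
  have \<theta>: "0 < \<theta>" "\<theta> \<le> 1" "r = \<theta> * s" "0 < s" using assms by (auto simp: \<theta>_def divide_simps)
  have "(1 - \<theta>) * (W2 (base \<Phi>) \<nu>)\<^sup>2 + \<theta> * (W2 (exp_push s \<Phi>) \<nu>)\<^sup>2
       \<le> (W2 (exp_push r \<Phi>) \<nu>)\<^sup>2 + \<theta> * (1 - \<theta>) * s\<^sup>2 * (speed \<Phi>)\<^sup>2"
    using W2_square_semiconcave[OF \<Phi> \<nu>, of \<theta> s] \<theta> by simp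
  then have "\<theta> * ((W2 (exp_push s \<Phi>) \<nu>)\<^sup>2 - (W2 (base \<Phi>) \<nu>)\<^sup>2)
      \<le> ((W2 (exp_push r \<Phi>) \<nu>)\<^sup>2 - (W2 (base \<Phi>) \<nu>)\<^sup>2) + \<theta> * (1 - \<theta>) * s\<^sup>2 * (speed \<Phi>)\<^sup>2"
    by (simp add: algebra_simps)
  then have "\<theta> * ((W2 (exp_push s \<Phi>) \<nu>)\<^sup>2 - (W2 (base \<Phi>) \<nu>)\<^sup>2) / (2 * r)
      \<le> (((W2 (exp_push r \<Phi>) \<nu>)\<^sup>2 - (W2 (base \<Phi>) \<nu>)\<^sup>2) + \<theta> * (1 - \<theta>) * s\<^sup>2 * (speed \<Phi>)\<^sup>2) / (2 * r)"
    using \<open>0 < r\<close> by (intro divide_right_mono) auto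
  moreover have "\<theta> * ((W2 (exp_push s \<Phi>) \<nu>)\<^sup>2 - (W2 (base \<Phi>) \<nu>)\<^sup>2) / (2 * r)
      = ((W2 (exp_push s \<Phi>) \<nu>)\<^sup>2 - (W2 (base \<Phi>) \<nu>)\<^sup>2) / (2 * s)"
    using \<theta> by simp
  moreover have "\<theta> * (1 - \<theta>) * s\<^sup>2 * (speed \<Phi>)\<^sup>2 / (2 * r) = s * (speed \<Phi>)\<^sup>2 / 2 - r * (speed \<Phi>)\<^sup>2 / 2"
    using \<theta> by (simp add: power2_eq_square field_simps)
  ultimately show ?thesis by (simp add: add_divide_distrib)
qed

lemma pairing_point_tendsto:
  assumes \<Phi>: "\<Phi> \<in> P2T" and \<nu>: "\<nu> \<in> P2"
  shows "((\<lambda>s. ((W2 (exp_push s \<Phi>) \<nu>)\<^sup>2 - (W2 (base \<Phi>) \<nu>)\<^sup>2) / (2 * s)) \<longlongrightarrow> pairing_point \<Phi> \<nu>) (at_right 0)"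
proof -
  define q where "q s = ((W2 (exp_push s \<Phi>) \<nu>)\<^sup>2 - (W2 (base \<Phi>) \<nu>)\<^sup>2) / (2 * s)" for s
  define p where "p s = s * (speed \<Phi>)\<^sup>2 / 2 - q s" for s
  have "((\<lambda>s. p s) \<longlongrightarrow> Inf (p ` ({0<..} \<inter> UNIV))) (at 0 within ({0<..} \<inter> UNIV))"
  proof (rule Lim_right_bound)
    fix a b :: real assume "0 < a" "a \<le> b"
    then show "p a \<le> p b" using W2_quotient_mono[OF \<Phi> \<nu>, of a b] by (simp add: p_def q_def)
  next
    fix a :: real assume "0 < a"
    then show "- (speed \<Phi> * W2 (base \<Phi>) \<nu>) \<le> p a" 
      using abs_le_D1[OF W2_quotient_bound[OF \<Phi> \<nu>, of a]] unfolding p_def q_def by linarith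
  qed
  then obtain L where "(p \<longlongrightarrow> L) (at_right 0)" by auto
  then have "((\<lambda>s. s * (speed \<Phi>)\<^sup>2 / 2 - p s) \<longlongrightarrow> 0 * (speed \<Phi>)\<^sup>2 / 2 - L) (at_right 0)"
    by (intro tendsto_intros) simp_all
  then have "(q \<longlongrightarrow> - L) (at_right 0)" by (simp add: p_def)
  moreover from this have "pairing_point \<Phi> \<nu> = - L"
    unfolding pairing_point_def q_def by (rule tendsto_Lim[rotated]) simp
  ultimately show ?thesis by (simp add: q_def[abs_def])
qed

text \<open>This is the inequality
  \<open>W2(exp\<^sup>s \<Phi>, \<nu>)\<^sup>2 / 2 \<le> W2(base \<Phi>, \<nu>)\<^sup>2 / 2 + s [\<Phi>, \<nu>] + s\<^sup>2 (speed \<Phi>)\<^sup>2 / 2\<close> for one Euler step.\<close>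

lemma pairing_point_lower_bound:
  assumes \<Phi>: "\<Phi> \<in> P2T" and \<nu>: "\<nu> \<in> P2" and "0 < s"
  shows "((W2 (exp_push s \<Phi>) \<nu>)\<^sup>2 - (W2 (base \<Phi>) \<nu>)\<^sup>2) / (2 * s) - s * (speed \<Phi>)\<^sup>2 / 2 \<le> pairing_point \<Phi> \<nu>"
    (is "?q \<le> _")
proof (rule tendsto_lowerbound)
  let ?p = "\<lambda>r. ((W2 (exp_push r \<Phi>) \<nu>)\<^sup>2 - (W2 (base \<Phi>) \<nu>)\<^sup>2) / (2 * r) - r * (speed \<Phi>)\<^sup>2 / 2"
  have "(?p \<longlongrightarrow> pairing_point \<Phi> \<nu> - 0 * (speed \<Phi>)\<^sup>2 / 2) (at_right 0)"
    by (intro tendsto_intros pairing_point_tendsto[OF \<Phi> \<nu>]) simp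
  then show "(?p \<longlongrightarrow> pairing_point \<Phi> \<nu>) (at_right 0)" by simp
  show "\<forall>\<^sub>F r in at_right 0. ?q \<le> ?p r"
    unfolding eventually_at_right_field using W2_quotient_mono[OF \<Phi> \<nu>] \<open>0 < s\<close> less_imp_le by blast
qed simp

lemma pairing_point_upper_bound:
  assumes \<Phi>: "\<Phi> \<in> P2T" and \<nu>: "\<nu> \<in> P2"
  shows "pairing_point \<Phi> \<nu> \<le> speed \<Phi> * W2 (base \<Phi>) \<nu>"
proof (rule tendsto_le[OF _ _ pairing_point_tendsto[OF \<Phi> \<nu>]])
  have "((\<lambda>s. speed \<Phi> * W2 (base \<Phi>) \<nu> + s * (speed \<Phi>)\<^sup>2 / 2) \<longlongrightarrow> speed \<Phi> * W2 (base \<Phi>) \<nu> + 0 * (speed \<Phi>)\<^sup>2 / 2) (at_right 0)"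
    by (intro tendsto_intros) simp
  then show "((\<lambda>s. speed \<Phi> * W2 (base \<Phi>) \<nu> + s * (speed \<Phi>)\<^sup>2 / 2) \<longlongrightarrow> speed \<Phi> * W2 (base \<Phi>) \<nu>) (at_right 0)"
    by simp
  have "((W2 (exp_push s \<Phi>) \<nu>)\<^sup>2 - (W2 (base \<Phi>) \<nu>)\<^sup>2) / (2 * s) \<le> speed \<Phi> * W2 (base \<Phi>) \<nu> + s * (speed \<Phi>)\<^sup>2 / 2"
    if "0 < s" for s
    using W2_quotient_bound[OF \<Phi> \<nu> that] by linarith
  then show "\<forall>\<^sub>F s in at_right 0. ((W2 (exp_push s \<Phi>) \<nu>)\<^sup>2 - (W2 (base \<Phi>) \<nu>)\<^sup>2) / (2 * s)
      \<le> speed \<Phi> * W2 (base \<Phi>) \<nu> + s * (speed \<Phi>)\<^sup>2 / 2"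
    unfolding eventually_at_right_field using zero_less_one by blast
qed simp

section \<open>Distributional inequalities with continuous bounds\<close>

text \<open>The recursion through the derivative makes closure under products and affine substitutions a
  plain induction on \<open>n\<close>.\<close>

primrec differentiable_times :: "nat \<Rightarrow> (real \<Rightarrow> real) \<Rightarrow> bool" where
  "differentiable_times 0 f = (\<forall>t. f differentiable (at t))"
| "differentiable_times (Suc n) f = ((\<forall>t. f differentiable (at t)) \<and> differentiable_times n (deriv f))"

lemma differentiable_timesD: "differentiable_times n f \<Longrightarrow> f differentiable (at t)"
  by (cases n) auto

lemma differentiable_times_Suc_imp: "differentiable_times (Suc n) f \<Longrightarrow> differentiable_times n f"
  by (induction n arbitrary: f) auto

lemma differentiable_times_iterate: "differentiable_times n f \<Longrightarrow> (deriv ^^ n) f differentiable (at t)"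
  by (induction n arbitrary: f) (auto simp: funpow_swap1)

lemma differentiable_times_DERIV:
  "differentiable_times n f \<Longrightarrow> (f has_real_derivative deriv f t) (at t)"
  using differentiable_timesD DERIV_deriv_iff_real_differentiable by blast

lemma differentiable_times_SucI:
  assumes "\<And>t. (f has_real_derivative f' t) (at t)" "differentiable_times n f'"
  shows "differentiable_times (Suc n) f"
proof -
  have "deriv f = f'" using assms(1) by (auto intro!: ext DERIV_imp_deriv)
  then show ?thesis using assms by (auto simp: real_differentiable_def)
qed

lemma differentiable_times_0I:
  "(\<And>t. (f has_real_derivative f' t) (at t)) \<Longrightarrow> differentiable_times 0 f"
  by (auto simp: real_differentiable_def)

lemma differentiable_times_add:
  "differentiable_times n f \<Longrightarrow> differentiable_times n g \<Longrightarrow> differentiable_times n (\<lambda>t. f t + g t)"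
proof (induction n arbitrary: f g)
  case (Suc n)
  show ?case
    by (rule differentiable_times_SucI[where f'="\<lambda>t. deriv f t + deriv g t"])
      (use Suc in \<open>auto intro!: DERIV_add differentiable_times_DERIV[of "Suc n"]\<close>)
qed (auto intro: differentiable_add)

lemma differentiable_times_mult:
  "differentiable_times n f \<Longrightarrow> differentiable_times n g \<Longrightarrow> differentiable_times n (\<lambda>t. f t * g t)"
proof (induction n arbitrary: f g)
  case (Suc n)
  have "differentiable_times n (\<lambda>t. deriv f t * g t + deriv g t * f t)"
    using Suc.prems Suc.prems[THEN differentiable_times_Suc_imp]
    by (intro differentiable_times_add Suc.IH) auto
  then show ?case
    by (rule differentiable_times_SucI[rotated])
      (use Suc.prems in \<open>auto intro!: DERIV_mult differentiable_times_DERIV[of "Suc n"]\<close>)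
qed (auto intro: differentiable_mult)

lemma differentiable_times_const: "differentiable_times n (\<lambda>t. c)"
  by (induction n arbitrary: c) auto

lemma differentiable_times_affine:
  "differentiable_times n f \<Longrightarrow> differentiable_times n (\<lambda>t. f (a * t + c))"
proof (induction n arbitrary: f)
  case 0
  have "((\<lambda>t. f (a * t + c)) has_real_derivative deriv f (a * t + c) * a) (at t)" for t
    by (rule DERIV_chain2[OF differentiable_times_DERIV[OF 0]]) (auto intro!: derivative_eq_intros)
  then show ?case by (rule differentiable_times_0I)
next
  case (Suc n)
  have "((\<lambda>t. f (a * t + c)) has_real_derivative deriv f (a * t + c) * a) (at t)" for t
    by (rule DERIV_chain2[OF differentiable_times_DERIV[OF Suc.prems]]) (auto intro!: derivative_eq_intros)
  moreover have "differentiable_times n (\<lambda>t. deriv f (a * t + c) * a)"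
    using Suc.prems by (intro differentiable_times_mult differentiable_times_const Suc.IH) auto
  ultimately show ?case by (rule differentiable_times_SucI)
qed

text \<open>The functions \<open>p(1/t) exp(-1/t)\<close>, extended by zero, form a class that is closed under
  differentiation; their smoothness is therefore immediate by induction.\<close>

definition flat_exp :: "real poly \<Rightarrow> real \<Rightarrow> real" where
  "flat_exp p t = (if 0 < t then poly p (1 / t) * exp (- (1 / t)) else 0)"

lemma flat_exp_tendsto_0: "(flat_exp p \<longlongrightarrow> 0) (at 0)"
proof -
  have "((\<lambda>y. \<Sum>i\<le>degree p. coeff p i * (y ^ i / exp y)) \<longlongrightarrow> (\<Sum>i\<le>degree p. coeff p i * 0)) at_top"
    by (intro tendsto_sum tendsto_mult tendsto_const tendsto_power_div_exp_0)
  moreover have "(\<Sum>i\<le>degree p. coeff p i * (y ^ i / exp y)) = poly p y * exp (- y)" for y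
    unfolding poly_altdef sum_distrib_right by (intro sum.cong refl) (simp only: exp_minus divide_inverse mult.assoc)
  ultimately have "((\<lambda>y. poly p y * exp (- y)) \<longlongrightarrow> 0) at_top" by simp
  then have "((\<lambda>t. poly p (inverse t) * exp (- inverse t)) \<longlongrightarrow> 0) (at_right 0)"
    by (rule filterlim_compose) (rule filterlim_inverse_at_top_right)
  moreover have "\<forall>\<^sub>F t in at_right 0. poly p (inverse t) * exp (- inverse t) = flat_exp p t"
    by (auto simp: eventually_at_right_field flat_exp_def inverse_eq_divide intro!: exI[of _ 1])
  ultimately have r: "(flat_exp p \<longlongrightarrow> 0) (at_right 0)"
    using tendsto_cong by fastforce
  have "\<forall>\<^sub>F t in at_left 0. 0 = flat_exp p t"
    by (auto simp: eventually_at_left_field flat_exp_def intro!: exI[of _ "-1"])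
  then have l: "(flat_exp p \<longlongrightarrow> 0) (at_left 0)" by (rule tendsto_eventually[OF eventually_mono]) simp
  show ?thesis using l r by (simp add: filterlim_split_at)
qed

lemma flat_exp_DERIV:
  "(flat_exp p has_real_derivative flat_exp ([:0, 0, 1:] * (p - pderiv p)) t) (at t)"
proof (cases t "0 :: real" rule: linorder_cases)
  case less
  have "((\<lambda>t. 0) has_real_derivative 0) (at t)" by simp
  then have "(flat_exp p has_real_derivative 0) (at t)"
    by (rule has_field_derivative_transform_within_open[of _ _ _ "{..<0}"]) (use less in \<open>auto simp: flat_exp_def\<close>)
  then show ?thesis using less by (simp add: flat_exp_def)
next
  case greater
  have "((\<lambda>t. poly p (1 / t) * exp (- (1 / t))) has_real_derivative
      poly (pderiv p) (1 / t) * (- 1 / t\<^sup>2) * exp (- (1 / t)) + exp (- (1 / t)) * (1 / t\<^sup>2) * poly p (1 / t)) (at t)"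
  proof (rule DERIV_mult)
    show "((\<lambda>t. poly p (1 / t)) has_real_derivative poly (pderiv p) (1 / t) * (- 1 / t\<^sup>2)) (at t)"
      by (rule DERIV_chain2[OF poly_DERIV])
        (use greater in \<open>auto intro!: derivative_eq_intros simp: power2_eq_square\<close>)
    show "((\<lambda>t. exp (- (1 / t))) has_real_derivative exp (- (1 / t)) * (1 / t\<^sup>2)) (at t)"
      using greater by (auto intro!: derivative_eq_intros simp: power2_eq_square)
  qed
  then have "(flat_exp p has_real_derivative
      poly (pderiv p) (1 / t) * (- 1 / t\<^sup>2) * exp (- (1 / t)) + exp (- (1 / t)) * (1 / t\<^sup>2) * poly p (1 / t)) (at t)"
    by (rule has_field_derivative_transform_within_open[of _ _ _ "{0<..}"]) (use greater in \<open>auto simp: flat_exp_def\<close>)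
  then show ?thesis using greater by (simp add: flat_exp_def power2_eq_square field_simps)
next
  case equal
  have "(flat_exp (pCons 0 p) \<longlongrightarrow> 0) (at 0)" by (rule flat_exp_tendsto_0)
  also have "flat_exp (pCons 0 p) = (\<lambda>h. (flat_exp p (0 + h) - flat_exp p 0) / h)"
    by (auto simp: flat_exp_def)
  finally show ?thesis using equal by (simp add: DERIV_def flat_exp_def)
qed

lemma differentiable_times_flat_exp: "differentiable_times n (flat_exp p)"
proof (induction n arbitrary: p)
  case 0 show ?case by (rule differentiable_times_0I[OF flat_exp_DERIV])
next
  case (Suc n) show ?case by (rule differentiable_times_SucI[OF flat_exp_DERIV Suc])
qed

text \<open>The step is an antiderivative of the bump
  \<open>\<rho>(t) = exp(-1/(t + \<epsilon>)) exp(-1/(\<epsilon> - t))\<close>, supported in \<open>[-\<epsilon>, \<epsilon>]\<close>; its height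
  \<open>R \<epsilon> - R (- \<epsilon>)\<close> is positive but not normalised.\<close>

lemma smooth_step:
  fixes \<epsilon> :: real
  assumes "\<epsilon> > 0"
  obtains R \<rho> :: "real \<Rightarrow> real" where
    "\<And>n. differentiable_times n R" "\<And>t. (R has_real_derivative \<rho> t) (at t)"
    "continuous_on UNIV \<rho>" "\<And>t. 0 \<le> \<rho> t" "\<And>t. \<epsilon> \<le> \<bar>t\<bar> \<Longrightarrow> \<rho> t = 0"
    "\<And>t. t \<le> - \<epsilon> \<Longrightarrow> R t = R (- \<epsilon>)" "\<And>t. \<epsilon> \<le> t \<Longrightarrow> R t = R \<epsilon>"
    "\<And>s t. s \<le> t \<Longrightarrow> R s \<le> R t" "R (- \<epsilon>) < R \<epsilon>"
proof -
  define \<rho> where "\<rho> t = flat_exp 1 (1 * t + \<epsilon>) * flat_exp 1 ((-1) * t + \<epsilon>)" for t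
  have diff: "differentiable_times n \<rho>" for n
    unfolding \<rho>_def by (intro differentiable_times_mult differentiable_times_affine differentiable_times_flat_exp)
  have cont: "continuous_on UNIV \<rho>"
    using differentiable_timesD[OF diff] by (auto intro!: continuous_at_imp_continuous_on differentiable_imp_continuous_within)
  have nonneg: "0 \<le> \<rho> t" for t by (simp add: \<rho>_def flat_exp_def)
  have zero: "\<rho> t = 0" if "\<epsilon> \<le> \<bar>t\<bar>" for t using that by (auto simp: \<rho>_def flat_exp_def)
  have pos: "0 < \<rho> t" if "- \<epsilon> < t" "t < \<epsilon>" for t using that by (simp add: \<rho>_def flat_exp_def)
  have "\<exists>R. \<forall>x. - \<infinity> < ereal x \<longrightarrow> ereal x < \<infinity> \<longrightarrow> (R has_vector_derivative \<rho> x) (at x)"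
    by (rule einterval_antiderivative) (use cont in \<open>auto simp: continuous_on_eq_continuous_at\<close>)
  then obtain R where R: "(R has_real_derivative \<rho> t) (at t)" for t
    by (auto simp: has_real_derivative_iff_has_vector_derivative)
  have dR: "differentiable_times n R" for n
    using differentiable_times_Suc_imp[OF differentiable_times_SucI[OF R diff]] .
  have mono: "R s \<le> R t" if "s \<le> t" for s t
    by (rule DERIV_nonneg_imp_nondecreasing[OF that, of R]) (use R nonneg in auto)
  have lt: "R (- \<epsilon>) < R \<epsilon>"
  proof (rule DERIV_pos_imp_increasing_open[of "- \<epsilon>" \<epsilon> R])
    show "continuous_on {- \<epsilon>..\<epsilon>} R" by (rule DERIV_continuous_on[OF has_field_derivative_at_within[OF R]])
    fix x assume "- \<epsilon> < x" "x < \<epsilon>"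
    then show "\<exists>y. (R has_real_derivative y) (at x) \<and> 0 < y"
      by (intro exI[of _ "\<rho> x"] conjI R pos)
  qed (use assms in simp_all)
  have left: "R t = R (- \<epsilon>)" if "t \<le> - \<epsilon>" for t
  proof (rule antisym[OF mono[OF that]])
    show "R (- \<epsilon>) \<le> R t"
    proof (rule DERIV_nonpos_imp_nonincreasing[OF that, of R])
      fix x assume "t \<le> x" "x \<le> - \<epsilon>"
      then have "\<rho> x = 0" using assms by (intro zero) simp
      then show "\<exists>y. (R has_real_derivative y) (at x) \<and> y \<le> 0" using R[of x] by (metis order_refl)
    qed
  qed
  have right: "R t = R \<epsilon>" if "\<epsilon> \<le> t" for t
  proof (rule antisym[OF _ mono[OF that]])
    show "R t \<le> R \<epsilon>"
    proof (rule DERIV_nonpos_imp_nonincreasing[OF that, of R])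
      fix x assume "\<epsilon> \<le> x" "x \<le> t"
      then have "\<rho> x = 0" using assms by (intro zero) simp
      then show "\<exists>y. (R has_real_derivative y) (at x) \<and> y \<le> 0" using R[of x] by (metis order_refl)
    qed
  qed
  show ?thesis 
    by (rule that[of R \<rho>], rule dR, rule R, rule cont, rule nonneg, erule zero,
        erule left, erule right, erule mono, rule lt)
qed

lemma lborel_integral_compact_support:
  fixes f :: "real \<Rightarrow> real"
  assumes c: "continuous_on {\<alpha>..\<beta>} f" and 0: "\<And>t. t \<notin> {\<alpha>..\<beta>} \<Longrightarrow> f t = 0"
  shows "integrable lborel f" "integral\<^sup>L lborel f = integral {\<alpha>..\<beta>} f"
proof -
  have s: "set_integrable lborel {\<alpha>..\<beta>} f" by (rule borel_integrable_atLeastAtMost'[OF c])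
  have eq: "(\<lambda>t. indicator {\<alpha>..\<beta>} t *\<^sub>R f t) = f" 
  proof
    fix t show "indicator {\<alpha>..\<beta>} t *\<^sub>R f t = f t" using 0[of t] by (cases "t \<in> {\<alpha>..\<beta>}") simp_all
  qed
  show "integrable lborel f" using s by (simp only: set_integrable_def eq)
  show "integral\<^sup>L lborel f = integral {\<alpha>..\<beta>} f"
    using set_borel_integral_eq_integral(2)[OF s] by (simp only: set_lebesgue_integral_def eq)
qed

text \<open>A difference of two translates of a smooth step is a test function that approximates the
  indicator of \<open>[a, b]\<close>.  If \<open>w = u - \<integral>h\<close> were larger at \<open>b\<close> than at \<open>a\<close>, testing with steps so
  narrow that \<open>w\<close> is almost constant on their supports would contradict \<open>w' \<le> 0\<close>.  The
  continuous bounds \<open>l\<close> and \<open>h\<close> make \<open>g\<close> integrable against test functions.\<close>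

lemma distr_deriv_le_imp_increment_le:
  fixes u g h l :: "real \<Rightarrow> real"
  assumes D: "distr_deriv_le J u g" and J: "open J" and ab: "a \<le> b" "{a..b} \<subseteq> J"
    and u: "continuous_on J u" and h: "continuous_on J h" and l: "continuous_on J l"
    and lgh: "\<And>t. t \<in> J \<Longrightarrow> l t \<le> g t" "\<And>t. t \<in> J \<Longrightarrow> g t \<le> h t"
    and g: "(\<lambda>t. indicator J t * g t) \<in> borel_measurable borel"
  shows "u b - u a \<le> integral {a..b} h"
proof (rule ccontr)
  assume contra: "\<not> u b - u a \<le> integral {a..b} h"
  obtain e where e: "e > 0" "{a - e..b + e} \<subseteq> J"
  proof -
    have ne: "a \<in> J" "b \<in> J" using ab by auto
    obtain e1 where e1: "e1 > 0" "cball a e1 \<subseteq> J" using J ne open_contains_cball by blast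
    obtain e2 where e2: "e2 > 0" "cball b e2 \<subseteq> J" using J ne open_contains_cball by blast
    have "t \<in> J" if "t \<in> {a - min e1 e2..b + min e1 e2}" for t
    proof (cases "t < a")
      case True
      then have "t \<in> cball a e1" using that by (auto simp: dist_real_def)
      then show ?thesis using e1 by auto
    next
      case False
      show ?thesis
      proof (cases "b < t")
        case True
        then have "t \<in> cball b e2" using that by (auto simp: dist_real_def)
        then show ?thesis using e2 by auto
      next
        case False
        then show ?thesis using \<open>\<not> t < a\<close> ab by auto
      qed
    qed
    then have "{a - min e1 e2..b + min e1 e2} \<subseteq> J" by blast
    with e1(1) e2(1) show ?thesis by (intro that) auto
  qed
  define \<alpha> where "\<alpha> = a - e"
  define \<beta> where "\<beta> = b + e"
  define K where "K = {\<alpha>..\<beta>}"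
  have K: "K \<subseteq> J" "a \<in> K" "b \<in> K"
    using e ab(1) unfolding K_def \<alpha>_def \<beta>_def by simp_all
  have uK: "continuous_on K u" and hK: "continuous_on K h" and lK: "continuous_on K l"
    using continuous_on_subset[OF _ K(1)] u h l by auto
  define H where "H t = integral {\<alpha>..t} h" for t
  have H: "(H has_real_derivative h t) (at t within K)" if "t \<in> K" for t
    using integral_has_real_derivative[of \<alpha> \<beta> h t] hK that unfolding H_def K_def by auto
  have HK: "continuous_on K H" using H by (rule DERIV_continuous_on)
  define w where "w t = u t - H t" for t
  have wK: "continuous_on K w" unfolding w_def by (intro continuous_intros uK HK)
  have "H b = H a + integral {a..b} h"
  proof -
    have "h integrable_on {\<alpha>..b}"
      by (rule integrable_continuous_real) (rule continuous_on_subset[OF hK], use K(3) in \<open>auto simp: K_def\<close>)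
    then have "integral {\<alpha>..a} h + integral {a..b} h = integral {\<alpha>..b} h"
      using ab e by (intro Henstock_Kurzweil_Integration.integral_combine) (auto simp: \<alpha>_def)
    then show ?thesis by (simp add: H_def)
  qed
  then have "w a < w b" using contra by (simp add: w_def)
  \<comment> \<open>A third of the gap: the values of w near a and near b stay separated.\<close>
  define \<eta> where "\<eta> = (w b - w a) / 3"
  have \<eta>: "\<eta> > 0" "w a + \<eta> < w b - \<eta>" using \<open>w a < w b\<close> by (auto simp: \<eta>_def field_simps)
  obtain d1 where d1: "d1 > 0" "\<And>t. t \<in> K \<Longrightarrow> dist t a < d1 \<Longrightarrow> dist (w t) (w a) < \<eta>"
    using wK[unfolded continuous_on_iff] K(2) \<eta>(1) by blast
  obtain d2 where d2: "d2 > 0" "\<And>t. t \<in> K \<Longrightarrow> dist t b < d2 \<Longrightarrow> dist (w t) (w b) < \<eta>"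
    using wK[unfolded continuous_on_iff] K(3) \<eta>(1) by blast
  define \<epsilon> where "\<epsilon> = min e (min d1 d2) / 2"
  have \<epsilon>: "\<epsilon> > 0" "\<epsilon> < e" "\<epsilon> < d1" "\<epsilon> < d2" using e(1) d1(1) d2(1) by (auto simp: \<epsilon>_def)
  obtain R \<rho> :: "real \<Rightarrow> real" where
    R: "\<And>n. differentiable_times n R" "\<And>t. (R has_real_derivative \<rho> t) (at t)" and
    \<rho>: "continuous_on UNIV \<rho>" "\<And>t. 0 \<le> \<rho> t" "\<And>t. \<epsilon> \<le> \<bar>t\<bar> \<Longrightarrow> \<rho> t = 0" and
    R': "\<And>t. t \<le> - \<epsilon> \<Longrightarrow> R t = R (- \<epsilon>)" "\<And>t. \<epsilon> \<le> t \<Longrightarrow> R t = R \<epsilon>"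
      "\<And>s t. s \<le> t \<Longrightarrow> R s \<le> R t" "R (- \<epsilon>) < R \<epsilon>"
  proof (rule smooth_step[OF \<epsilon>(1)], goal_cases)
    case (1 R \<rho>)
    show ?case
      by (rule 1(1)[of R \<rho>], rule 1(2), rule 1(3), rule 1(4), rule 1(5), erule 1(6), erule 1(7),
          erule 1(8), erule 1(9), rule 1(10))
  qed
  define \<phi> where "\<phi> t = R (1 * t + (- a)) + (-1) * R (1 * t + (- b))" for t
  have smooth: "differentiable_times n \<phi>" for n unfolding \<phi>_def
    by (intro differentiable_times_add differentiable_times_mult differentiable_times_const differentiable_times_affine R)
  have R_shift: "((\<lambda>t. R (1 * t + c)) has_real_derivative \<rho> (1 * t + c) * 1) (at t)" for c t
    by (rule DERIV_chain2[OF R(2)]) (auto intro!: derivative_eq_intros)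
  have \<phi>': "(\<phi> has_real_derivative \<rho> (t - a) - \<rho> (t - b)) (at t)" for t
    using DERIV_add[OF R_shift[of "- a" t] DERIV_cmult[OF R_shift[of "- b" t], of "- 1"]]
    unfolding \<phi>_def[abs_def] by simp
  then have d\<phi>: "deriv \<phi> = (\<lambda>t. \<rho> (t - a) - \<rho> (t - b))" by (auto intro!: ext DERIV_imp_deriv)
  have \<phi>c: "continuous_on S \<phi>" for S
    by (rule DERIV_continuous_on[OF has_field_derivative_at_within[OF \<phi>']])
  have \<phi>0: "\<phi> t = 0" if "t \<notin> {a - \<epsilon>..b + \<epsilon>}" for t
  proof (cases "t < a - \<epsilon>")
    case True
    then have "R (t - a) = R (- \<epsilon>)" "R (t - b) = R (- \<epsilon>)" using ab by (auto intro!: R'(1))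
    then show ?thesis by (simp add: \<phi>_def)
  next
    case False
    then have "b + \<epsilon> < t" using that by auto
    then have "R (t - a) = R \<epsilon>" "R (t - b) = R \<epsilon>" using ab by (auto intro!: R'(2))
    then show ?thesis by (simp add: \<phi>_def)
  qed
  have \<phi>nn: "0 \<le> \<phi> t" for t using R'(3)[of "t - b" "t - a"] ab by (simp add: \<phi>_def)
  have "{t. \<phi> t \<noteq> 0} \<subseteq> {a - \<epsilon>..b + \<epsilon>}" using \<phi>0 by blast
  then have cl: "closure {t. \<phi> t \<noteq> 0} \<subseteq> {a - \<epsilon>..b + \<epsilon>}" by (intro closure_minimal) auto
  have sub: "{a - \<epsilon>..b + \<epsilon>} \<subseteq> K" using \<epsilon> by (auto simp: K_def \<alpha>_def \<beta>_def)
  have "compact (closure {t. \<phi> t \<noteq> 0})"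
    using cl by (meson bounded_subset compact_Icc compact_closure compact_imp_bounded closure_subset order_trans)
  then have "nonneg_test_function J \<phi>"
    unfolding nonneg_test_function_def using differentiable_times_iterate[OF smooth] cl sub K(1) \<phi>nn by auto
  then have EVI: "- (\<integral>t. u t * deriv \<phi> t \<partial>lborel) \<le> (\<integral>t. g t * \<phi> t \<partial>lborel)"
    using D by (simp add: distr_deriv_le_def)
  have \<phi>K: "\<phi> t = 0" if "t \<notin> {\<alpha>..\<beta>}" for t using \<phi>0[of t] sub that unfolding K_def by blast
  have \<rho>K: "\<rho> (t - a) = 0" "\<rho> (t - b) = 0" if "t \<notin> {\<alpha>..\<beta>}" for t
    using \<rho>(3)[of "t - a"] \<rho>(3)[of "t - b"] that \<epsilon> ab by (auto simp: \<alpha>_def \<beta>_def)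
  have \<rho>c: "continuous_on K (\<lambda>t. \<rho> (t - c))" for c
    by (rule continuous_on_compose2[OF \<rho>(1)]) (auto intro!: continuous_intros)
  have hi: "integrable lborel (\<lambda>t. h t * \<phi> t)" "(\<integral>t. h t * \<phi> t \<partial>lborel) = integral K (\<lambda>t. h t * \<phi> t)"
    unfolding K_def by (rule lborel_integral_compact_support; use hK \<phi>c \<phi>K in \<open>auto intro!: continuous_intros simp: K_def\<close>)+
  have li: "integrable lborel (\<lambda>t. l t * \<phi> t)"
    by (rule lborel_integral_compact_support[of \<alpha> \<beta>]; use lK \<phi>c \<phi>K in \<open>auto intro!: continuous_intros simp: K_def\<close>)
  have ui: "(\<integral>t. u t * deriv \<phi> t \<partial>lborel) = integral K (\<lambda>t. u t * (\<rho> (t - a) - \<rho> (t - b)))"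
    unfolding K_def d\<phi> by (rule lborel_integral_compact_support; use uK \<rho>c \<rho>K in \<open>auto intro!: continuous_intros simp: K_def\<close>)
  have bounds: "l t * \<phi> t \<le> g t * \<phi> t" "g t * \<phi> t \<le> h t * \<phi> t" for t
    using lgh[of t] \<phi>nn[of t] \<phi>K[of t] K(1) by (cases "t \<in> K"; auto simp: K_def intro!: mult_right_mono)+
  have gi: "integrable lborel (\<lambda>t. g t * \<phi> t)"
  proof (rule Bochner_Integration.integrable_bound)
    show "integrable lborel (\<lambda>t. \<bar>l t * \<phi> t\<bar> + \<bar>h t * \<phi> t\<bar>)" using li hi by auto
    have "\<phi> \<in> borel_measurable borel" using \<phi>c by (rule borel_measurable_continuous_onI)
    then have "(\<lambda>t. (indicator J t * g t) * \<phi> t) \<in> borel_measurable borel" using g by measurable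
    also have "(\<lambda>t. (indicator J t * g t) * \<phi> t) = (\<lambda>t. g t * \<phi> t)"
    proof
      fix t show "(indicator J t * g t) * \<phi> t = g t * \<phi> t"
        using \<phi>K[of t] K(1) by (cases "t \<in> K") (auto simp: K_def)
    qed
    finally show "(\<lambda>t. g t * \<phi> t) \<in> borel_measurable lborel" by simp
    show "AE t in lborel. norm (g t * \<phi> t) \<le> norm (\<bar>l t * \<phi> t\<bar> + \<bar>h t * \<phi> t\<bar>)"
    proof (rule AE_I2)
      fix t show "norm (g t * \<phi> t) \<le> norm (\<bar>l t * \<phi> t\<bar> + \<bar>h t * \<phi> t\<bar>)"
        using bounds[of t] unfolding real_norm_def by linarith
    qed
  qed
  have "(\<integral>t. g t * \<phi> t \<partial>lborel) \<le> (\<integral>t. h t * \<phi> t \<partial>lborel)"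
    by (rule integral_mono[OF gi hi(1)]) (rule bounds)
  then have 1: "- integral K (\<lambda>t. u t * (\<rho> (t - a) - \<rho> (t - b))) \<le> integral K (\<lambda>t. h t * \<phi> t)"
    using EVI hi ui by simp
  have ints: "(\<lambda>t. f t * \<rho> (t - c)) integrable_on K" "(\<lambda>t. f t * (\<rho> (t - a) - \<rho> (t - b))) integrable_on K"
    "(\<lambda>t. f t * \<phi> t) integrable_on K"
    if "continuous_on K f" for f c
    using that \<rho>c \<phi>c unfolding K_def by (auto intro!: integrable_continuous_real continuous_intros)
  have "((\<lambda>t. H t * (\<rho> (t - a) - \<rho> (t - b)) + h t * \<phi> t) has_integral (H \<beta> * \<phi> \<beta> - H \<alpha> * \<phi> \<alpha>)) {\<alpha>..\<beta>}"
  proof (rule fundamental_theorem_of_calculus)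
    show "\<alpha> \<le> \<beta>" using ab e by (simp add: \<alpha>_def \<beta>_def)
    fix t assume "t \<in> {\<alpha>..\<beta>}"
    then have "((\<lambda>t. H t * \<phi> t) has_real_derivative h t * \<phi> t + (\<rho> (t - a) - \<rho> (t - b)) * H t) (at t within {\<alpha>..\<beta>})"
      using DERIV_mult[OF H[of t] has_field_derivative_at_within[OF \<phi>'[of t]]] unfolding K_def by simp
    then show "((\<lambda>t. H t * \<phi> t) has_vector_derivative H t * (\<rho> (t - a) - \<rho> (t - b)) + h t * \<phi> t) (at t within {\<alpha>..\<beta>})"
      by (simp add: has_real_derivative_iff_has_vector_derivative algebra_simps)
  qed
  moreover have "\<phi> \<alpha> = 0" "\<phi> \<beta> = 0" using \<phi>0[of \<alpha>] \<phi>0[of \<beta>] \<epsilon> by (auto simp: \<alpha>_def \<beta>_def)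
  ultimately have "integral K (\<lambda>t. H t * (\<rho> (t - a) - \<rho> (t - b)) + h t * \<phi> t) = 0"
    unfolding K_def by (simp add: integral_unique)
  then have 2: "integral K (\<lambda>t. H t * (\<rho> (t - a) - \<rho> (t - b))) + integral K (\<lambda>t. h t * \<phi> t) = 0"
    using ints HK hK by (simp add: Henstock_Kurzweil_Integration.integral_add)
  have "0 \<le> integral K (\<lambda>t. u t * (\<rho> (t - a) - \<rho> (t - b))) - integral K (\<lambda>t. H t * (\<rho> (t - a) - \<rho> (t - b)))"
    using 1 2 by linarith
  also have "\<dots> = integral K (\<lambda>t. u t * (\<rho> (t - a) - \<rho> (t - b)) - H t * (\<rho> (t - a) - \<rho> (t - b)))"
    using ints uK HK by (intro Henstock_Kurzweil_Integration.integral_diff[symmetric]) auto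
  also have "\<dots> = integral K (\<lambda>t. w t * \<rho> (t - a) - w t * \<rho> (t - b))"
    by (simp add: w_def algebra_simps)
  also have "\<dots> = integral K (\<lambda>t. w t * \<rho> (t - a)) - integral K (\<lambda>t. w t * \<rho> (t - b))"
    using ints wK by (intro Henstock_Kurzweil_Integration.integral_diff) auto
  finally have 3: "integral K (\<lambda>t. w t * \<rho> (t - b)) \<le> integral K (\<lambda>t. w t * \<rho> (t - a))" by simp
  have mass: "((\<lambda>t. C * \<rho> (t - c)) has_integral C * (R \<epsilon> - R (- \<epsilon>))) K" if "c = a \<or> c = b" for c C
  proof -
    have "((\<lambda>t. \<rho> (t - c)) has_integral (R (\<beta> - c) - R (\<alpha> - c))) {\<alpha>..\<beta>}"
    proof (rule fundamental_theorem_of_calculus)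
      show "\<alpha> \<le> \<beta>" using ab e(1) by (simp add: \<alpha>_def \<beta>_def)
      show "((\<lambda>t. R (t - c)) has_vector_derivative \<rho> (t - c)) (at t within {\<alpha>..\<beta>})" for t
        using has_field_derivative_at_within[OF R_shift[of "- c" t]]
        by (simp add: has_real_derivative_iff_has_vector_derivative)
    qed
    moreover have "R (\<beta> - c) = R \<epsilon>" "R (\<alpha> - c) = R (- \<epsilon>)"
      using that \<epsilon> ab by (auto intro!: R' simp: \<alpha>_def \<beta>_def)
    ultimately show ?thesis unfolding K_def by (intro has_integral_mult_right) simp
  qed
  have "integral K (\<lambda>t. w t * \<rho> (t - a)) \<le> integral K (\<lambda>t. (w a + \<eta>) * \<rho> (t - a))"
  proof (rule integral_le)
    fix t assume "t \<in> K"
    show "w t * \<rho> (t - a) \<le> (w a + \<eta>) * \<rho> (t - a)"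
    proof (cases "\<epsilon> \<le> \<bar>t - a\<bar>")
      case False
      then have "dist (w t) (w a) < \<eta>" using d1(2)[OF \<open>t \<in> K\<close>] \<epsilon> by (simp add: dist_real_def)
      then show ?thesis using \<rho>(2) by (intro mult_right_mono) (auto simp: dist_real_def)
    qed (simp add: \<rho>(3))
  qed (use ints wK in auto)
  moreover have "integral K (\<lambda>t. (w b - \<eta>) * \<rho> (t - b)) \<le> integral K (\<lambda>t. w t * \<rho> (t - b))"
  proof (rule integral_le)
    fix t assume "t \<in> K"
    show "(w b - \<eta>) * \<rho> (t - b) \<le> w t * \<rho> (t - b)"
    proof (cases "\<epsilon> \<le> \<bar>t - b\<bar>")
      case False
      then have "dist (w t) (w b) < \<eta>" using d2(2)[OF \<open>t \<in> K\<close>] \<epsilon> by (simp add: dist_real_def)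
      then show ?thesis using \<rho>(2) by (intro mult_right_mono) (auto simp: dist_real_def)
    qed (simp add: \<rho>(3))
  qed (use ints wK in auto)
  ultimately have "(w b - \<eta>) * (R \<epsilon> - R (- \<epsilon>)) \<le> (w a + \<eta>) * (R \<epsilon> - R (- \<epsilon>))"
    using 3 integral_unique[OF mass[of a "w a + \<eta>"]] integral_unique[OF mass[of b "w b - \<eta>"]] by linarith
  then show False using R'(4) \<eta>(2) by (simp add: mult_le_cancel_right)
qed

section \<open>A transport inequality on a staircase\<close>

text \<open>The last point at which \<open>f\<close> does not exceed \<open>f a\<close> cannot lie to the left of \<open>b\<close>.\<close>

lemma le_start_if_locally_le:
  fixes f :: "real \<Rightarrow> real"
  assumes "a \<le> b" and cont: "continuous_on {a..b} f"
    and loc: "\<And>t. a \<le> t \<Longrightarrow> t < b \<Longrightarrow> \<exists>H>0. \<forall>h. 0 \<le> h \<and> h < H \<and> t + h \<le> b \<longrightarrow> f (t + h) \<le> f t"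
  shows "f b \<le> f a"
proof -
  define S where "S = {t \<in> {a..b}. f t \<le> f a}"
  have "closed S" unfolding S_def by (intro continuous_on_closed_Collect_le cont continuous_on_const) simp_all
  moreover have "bounded S" unfolding S_def by (rule bounded_subset[of "{a..b}"]) auto
  ultimately have "compact S" by (simp add: compact_eq_bounded_closed)
  moreover have "a \<in> S" using \<open>a \<le> b\<close> by (simp add: S_def)
  ultimately obtain s where s: "s \<in> S" "\<And>t. t \<in> S \<Longrightarrow> t \<le> s" using compact_attains_sup[of S] by blast
  have "s = b"
  proof (rule ccontr)
    assume "s \<noteq> b"
    then have sb: "a \<le> s" "s < b" "f s \<le> f a" using s(1) by (auto simp: S_def)
    obtain H where H: "H > 0" "\<And>h. 0 \<le> h \<Longrightarrow> h < H \<Longrightarrow> s + h \<le> b \<Longrightarrow> f (s + h) \<le> f s"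
      using loc[OF sb(1,2)] by blast
    define h where "h = min (H / 2) (b - s)"
    have h: "0 < h" "h < H" "s + h \<le> b" using H(1) sb by (auto simp: h_def)
    then have "s + h \<in> S" using H(2)[of h] sb by (auto simp: S_def)
    then show False using s(2)[of "s + h"] h by simp
  qed
  then show ?thesis using s(1) by (simp add: S_def)
qed

text \<open>The inequalities for the rows \<open>j, \<dots>, j + k - 1\<close> are summed \<^emph>\<open>before\<close> they are estimated: the
  difference quotients telescope to \<open>(e (j + k) - e j) / \<tau>\<close>, and integrated over one step this is
  exactly the change produced by shifting the window from \<open>j\<close> to \<open>j + 1\<close>, up to \<open>2 \<omega>\<close>.
  Estimating row by row would cost \<open>2 k \<omega>\<close> instead, which is too much.\<close>

lemma staircase_step:
  fixes e :: "nat \<Rightarrow> real \<Rightarrow> real"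
  assumes \<tau>: "0 < \<tau>"
    and cont: "\<And>n. n \<le> j + k \<Longrightarrow> continuous_on {s..s + \<tau>} (e n)"
    and step: "\<And>n. n < j + k \<Longrightarrow> e n (s + \<tau>) - e n s \<le>
      integral {s..s + \<tau>} (\<lambda>t. 2 * lam * e n t - (e (Suc n) t - e n t) / \<tau> + c)"
    and osc: "\<And>n x y. n \<le> j + k \<Longrightarrow> x \<in> {s..s + \<tau>} \<Longrightarrow> y \<in> {s..s + \<tau>} \<Longrightarrow> \<bar>e n x - e n y\<bar> \<le> \<omega>"
  shows "(\<Sum>i<k. e (Suc j + i) (s + \<tau>))
     \<le> (1 + 2 * lam * \<tau>) * (\<Sum>i<k. e (j + i) s) + (2 * \<bar>lam\<bar> * real k * \<omega> * \<tau> + 2 * \<omega> + real k * c * \<tau>)"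
proof -
  let ?K = "{s..s + \<tau>}" and ?S = "\<Sum>i<k. e (j + i) s"
  let ?D = "2 * lam * ?S + 2 * \<bar>lam\<bar> * (real k * \<omega>) - (e (j + k) (s + \<tau>) - e j (s + \<tau>)) / \<tau> + 2 * \<omega> / \<tau> + real k * c"
  have int: "(\<lambda>t. 2 * lam * e n t - (e (Suc n) t - e n t) / \<tau> + c) integrable_on ?K" if "n < j + k" for n
    using that \<tau> by (intro integrable_continuous_real continuous_intros cont) auto
  have "(\<Sum>i<k. e (j + i) (s + \<tau>)) - ?S = (\<Sum>i<k. e (j + i) (s + \<tau>) - e (j + i) s)"
    by (simp add: sum_subtractf)
  also have "\<dots> \<le> (\<Sum>i<k. integral ?K (\<lambda>t. 2 * lam * e (j + i) t - (e (Suc (j + i)) t - e (j + i) t) / \<tau> + c))"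
    by (intro sum_mono step) auto
  also have "\<dots> = integral ?K (\<lambda>t. \<Sum>i<k. 2 * lam * e (j + i) t - (e (Suc (j + i)) t - e (j + i) t) / \<tau> + c)"
    by (rule integral_sum[symmetric]) (auto intro!: int)
  also have "\<dots> \<le> integral ?K (\<lambda>t. ?D)"
  proof (rule integral_le)
    show "(\<lambda>t. \<Sum>i<k. 2 * lam * e (j + i) t - (e (Suc (j + i)) t - e (j + i) t) / \<tau> + c) integrable_on ?K"
      by (intro integrable_sum int) auto
    fix t assume t: "t \<in> ?K"
    \<comment> \<open>Only the boundary rows of the window survive.\<close>
    have tele: "(\<Sum>i<k. e (Suc (j + i)) t - e (j + i) t) = e (j + k) t - e j t"
      using sum_lessThan_telescope[of "\<lambda>i. e (j + i) t" k] by simp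
    have "(\<Sum>i<k. 2 * lam * e (j + i) t - (e (Suc (j + i)) t - e (j + i) t) / \<tau> + c)
        = 2 * lam * (\<Sum>i<k. e (j + i) t) - (e (j + k) t - e j t) / \<tau> + real k * c"
      by (simp add: sum.distrib sum_subtractf sum_distrib_left[symmetric] sum_divide_distrib[symmetric] tele[unfolded sum_subtractf])
    moreover have "2 * lam * (\<Sum>i<k. e (j + i) t) \<le> 2 * lam * ?S + 2 * \<bar>lam\<bar> * (real k * \<omega>)"
    proof -
      have "lam * (\<Sum>i<k. e (j + i) t) - lam * ?S = lam * (\<Sum>i<k. e (j + i) t - e (j + i) s)"
        by (simp add: sum_subtractf right_diff_distrib)
      also have "\<dots> \<le> \<bar>lam\<bar> * \<bar>\<Sum>i<k. e (j + i) t - e (j + i) s\<bar>"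
        by (metis abs_ge_self abs_mult)
      also have "\<dots> \<le> \<bar>lam\<bar> * (\<Sum>i<k. \<omega>)"
        using t \<tau> by (intro mult_left_mono order_trans[OF sum_abs] sum_mono osc) auto
      finally show ?thesis by simp
    qed
    moreover have "- ((e (j + k) t - e j t) / \<tau>) \<le> - ((e (j + k) (s + \<tau>) - e j (s + \<tau>)) / \<tau>) + 2 * \<omega> / \<tau>"
    proof -
      have "- (e (j + k) t - e j t) \<le> - (e (j + k) (s + \<tau>) - e j (s + \<tau>)) + 2 * \<omega>"
        using osc[of "j + k" t "s + \<tau>"] osc[of j t "s + \<tau>"] t \<tau> by auto
      then have "(- (e (j + k) t - e j t)) / \<tau> \<le> (- (e (j + k) (s + \<tau>) - e j (s + \<tau>)) + 2 * \<omega>) / \<tau>"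
        using \<tau> by (intro divide_right_mono) auto
      then show ?thesis by (simp only: add_divide_distrib minus_divide_left)
    qed
    ultimately show "(\<Sum>i<k. 2 * lam * e (j + i) t - (e (Suc (j + i)) t - e (j + i) t) / \<tau> + c) \<le> ?D"
      by linarith
  qed (rule integrable_continuous_real[OF continuous_on_const])
  also have "\<dots> = \<tau> * ?D" using \<tau> by simp
  also have "\<dots> = 2 * lam * \<tau> * ?S - (e (j + k) (s + \<tau>) - e j (s + \<tau>))
      + (2 * \<bar>lam\<bar> * real k * \<omega> * \<tau> + 2 * \<omega> + real k * c * \<tau>)"
    using \<tau> by (simp add: field_simps)
  finally have "(\<Sum>i<k. e (j + i) (s + \<tau>)) - ?S \<le> 2 * lam * \<tau> * ?S - (e (j + k) (s + \<tau>) - e j (s + \<tau>))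
      + (2 * \<bar>lam\<bar> * real k * \<omega> * \<tau> + 2 * \<omega> + real k * c * \<tau>)" .
  moreover have "(\<Sum>i<k. e (Suc j + i) (s + \<tau>)) = (\<Sum>i<k. e (j + i) (s + \<tau>)) + e (j + k) (s + \<tau>) - e j (s + \<tau>)"
    using sum_lessThan_telescope[of "\<lambda>i. e (j + i) (s + \<tau>)" k] by (simp add: sum_subtractf)
  ultimately show ?thesis by (simp add: algebra_simps)
qed

lemma discrete_Gronwall:
  fixes S :: "nat \<Rightarrow> real"
  assumes "\<And>j. j < m \<Longrightarrow> S (Suc j) \<le> (1 + r) * S j + E" "\<And>j. j \<le> m \<Longrightarrow> 0 \<le> S j" "0 \<le> E"
  shows "S m \<le> exp (r * m) * S 0 + E * m * exp (\<bar>r\<bar> * m)"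
proof -
  have "S j \<le> exp (r * j) * S 0 + E * j * exp (\<bar>r\<bar> * j)" if "j \<le> m" for j
    using that
  proof (induction j)
    case (Suc j)
    have "S (Suc j) \<le> (1 + r) * S j + E" using assms(1) Suc.prems by simp
    also have "\<dots> \<le> exp r * S j + E"
      using assms(2)[of j] Suc.prems by (intro add_right_mono mult_right_mono) auto
    also have "\<dots> \<le> exp r * (exp (r * j) * S 0 + E * j * exp (\<bar>r\<bar> * j)) + E"
      using Suc by (intro add_right_mono mult_left_mono) auto
    also have "\<dots> = exp (r * Suc j) * S 0 + E * j * (exp r * exp (\<bar>r\<bar> * j)) + E * 1"
      by (simp add: algebra_simps exp_add)
    also have "\<dots> \<le> exp (r * Suc j) * S 0 + E * j * exp (\<bar>r\<bar> * Suc j) + E * exp (\<bar>r\<bar> * Suc j)"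
    proof (intro add_mono mult_left_mono order_refl)
      have "exp r * exp (\<bar>r\<bar> * j) = exp (r + \<bar>r\<bar> * j)" by (simp add: exp_add)
      also have "\<dots> \<le> exp (\<bar>r\<bar> * Suc j)" by (simp add: algebra_simps)
      finally show "exp r * exp (\<bar>r\<bar> * j) \<le> exp (\<bar>r\<bar> * Suc j)" .
    qed (use assms(3) in auto)
    also have "\<dots> = exp (r * Suc j) * S 0 + E * Suc j * exp (\<bar>r\<bar> * Suc j)"
      by (simp add: algebra_simps)
    finally show ?case .
  qed simp
  then show ?thesis by simp
qed

text \<open>The average of \<open>e n t\<close> over a window of \<open>k\<close> rows satisfies a discrete Gronwall inequality along
  the diagonal \<open>t = s + j \<tau>\<close>, and differs from \<open>e j t\<close> by at most \<open>k \<delta>\<close>.  The term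
  \<open>2 \<omega> m / k\<close> shows why the window must contain many rows.\<close>

lemma staircase_estimate:
  fixes e :: "nat \<Rightarrow> real \<Rightarrow> real" and m k :: nat and s \<tau> lam \<omega> c \<delta> :: real
  assumes \<tau>: "0 < \<tau>" and k: "0 < k" and nonneg: "\<And>n t. 0 \<le> e n t" "0 \<le> \<omega>" "0 \<le> c"
    and cont: "\<And>n. n \<le> m + k \<Longrightarrow> continuous_on {s..s + m * \<tau>} (e n)"
    and step: "\<And>n a b. n < m + k \<Longrightarrow> s \<le> a \<Longrightarrow> a \<le> b \<Longrightarrow> b \<le> s + m * \<tau> \<Longrightarrow> e n b - e n a \<le>
      integral {a..b} (\<lambda>t. 2 * lam * e n t - (e (Suc n) t - e n t) / \<tau> + c)"
    and osc: "\<And>n x y. n \<le> m + k \<Longrightarrow> x \<in> {s..s + m * \<tau>} \<Longrightarrow> y \<in> {s..s + m * \<tau>} \<Longrightarrow> \<bar>x - y\<bar> \<le> \<tau>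
      \<Longrightarrow> \<bar>e n x - e n y\<bar> \<le> \<omega>"
    and lip: "\<And>n t. n < m + k \<Longrightarrow> t \<in> {s..s + m * \<tau>} \<Longrightarrow> \<bar>e (Suc n) t - e n t\<bar> \<le> \<delta>"
  shows "e m (s + m * \<tau>) \<le> exp (2 * lam * (m * \<tau>)) * (e 0 s + k * \<delta>) + k * \<delta>
     + (2 * \<bar>lam\<bar> * \<omega> * (m * \<tau>) + 2 * \<omega> * m / k + c * (m * \<tau>)) * exp (2 * \<bar>lam\<bar> * (m * \<tau>))"
proof -
  define S where "S j = (\<Sum>i<k. e (j + i) (s + real j * \<tau>))" for j :: nat
  define E where "E = 2 * \<bar>lam\<bar> * real k * \<omega> * \<tau> + 2 * \<omega> + real k * c * \<tau>"
  have "S (Suc j) \<le> (1 + 2 * lam * \<tau>) * S j + E" if "j < m" for j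
  proof -
    have le: "s + real j * \<tau> + \<tau> \<le> s + m * \<tau>"
    proof -
      have "real (Suc j) * \<tau> \<le> real m * \<tau>" using that \<tau> by (intro mult_right_mono) auto
      then show ?thesis by (simp add: algebra_simps)
    qed
    have sub: "{s + real j * \<tau>..s + real j * \<tau> + \<tau>} \<subseteq> {s..s + m * \<tau>}" using le \<tau> by auto
    have "(\<Sum>i<k. e (Suc j + i) (s + real j * \<tau> + \<tau>)) \<le> (1 + 2 * lam * \<tau>) * (\<Sum>i<k. e (j + i) (s + real j * \<tau>)) + E"
      unfolding E_def
    proof (rule staircase_step[OF \<tau>])
      fix n assume "n \<le> j + k"
      then show "continuous_on {s + real j * \<tau>..s + real j * \<tau> + \<tau>} (e n)"
        using that by (intro continuous_on_subset[OF cont sub]) auto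
    next
      fix n assume "n < j + k"
      then show "e n (s + real j * \<tau> + \<tau>) - e n (s + real j * \<tau>) \<le>
        integral {s + real j * \<tau>..s + real j * \<tau> + \<tau>} (\<lambda>t. 2 * lam * e n t - (e (Suc n) t - e n t) / \<tau> + c)"
        using that \<tau> le by (intro step) auto
    next
      fix n x y assume n: "n \<le> j + k" and xy: "x \<in> {s + real j * \<tau>..s + real j * \<tau> + \<tau>}" "y \<in> {s + real j * \<tau>..s + real j * \<tau> + \<tau>}"
      then have "\<bar>x - y\<bar> \<le> \<tau>" by auto
      moreover have "x \<in> {s..s + m * \<tau>}" "y \<in> {s..s + m * \<tau>}" using sub xy by blast+
      ultimately show "\<bar>e n x - e n y\<bar> \<le> \<omega>" using n that by (intro osc) auto
    qed
    then show ?thesis by (simp add: S_def algebra_simps)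
  qed
  moreover have "0 \<le> S j" for j unfolding S_def by (intro sum_nonneg nonneg)
  moreover have "0 \<le> E" using \<tau> nonneg unfolding E_def by (intro add_nonneg_nonneg mult_nonneg_nonneg) auto
  ultimately have "S m \<le> exp (2 * lam * \<tau> * m) * S 0 + E * m * exp (\<bar>2 * lam * \<tau>\<bar> * m)"
    by (intro discrete_Gronwall)
  also have "\<bar>2 * lam * \<tau>\<bar> * m = 2 * \<bar>lam\<bar> * (m * \<tau>)" using \<tau> by (simp add: abs_mult)
  also have "2 * lam * \<tau> * m = 2 * lam * (m * \<tau>)" by simp
  finally have S: "S m \<le> exp (2 * lam * (m * \<tau>)) * S 0 + E * m * exp (2 * \<bar>lam\<bar> * (m * \<tau>))" .
  have "\<bar>e (Suc 0) s - e 0 s\<bar> \<le> \<delta>" by (rule lip) (use k \<tau> in auto)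
  then have \<delta>: "0 \<le> \<delta>" by linarith
  have near: "\<bar>e (j + i) t - e j t\<bar> \<le> i * \<delta>" if "j + i \<le> m + k" "t \<in> {s..s + m * \<tau>}" for i j t
    using that(1)
  proof (induction i)
    case (Suc i)
    then show ?case using lip[of "j + i" t] that(2) by (simp add: algebra_simps)
  qed simp
  have ki: "real i * \<delta> \<le> k * \<delta>" if "i < k" for i using that \<delta> by (intro mult_right_mono) auto
  have "S 0 \<le> (\<Sum>i<k. e 0 s + k * \<delta>)" unfolding S_def
  proof (rule sum_mono)
    fix i assume "i \<in> {..<k}"
    then show "e (0 + i) (s + real 0 * \<tau>) \<le> e 0 s + k * \<delta>"
      using near[of 0 i s] ki[of i] \<tau> by (simp add: abs_le_iff)
  qed
  then have S0: "S 0 \<le> k * (e 0 s + k * \<delta>)" by simp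
  have "(\<Sum>i<k. e m (s + m * \<tau>) - k * \<delta>) \<le> S m" unfolding S_def
  proof (rule sum_mono)
    fix i assume "i \<in> {..<k}"
    then show "e m (s + m * \<tau>) - k * \<delta> \<le> e (m + i) (s + m * \<tau>)"
      using near[of m i "s + m * \<tau>"] ki[of i] \<tau> by (simp add: abs_le_iff)
  qed
  then have "k * (e m (s + m * \<tau>) - k * \<delta>) \<le> S m" by simp
  also note S
  also have "exp (2 * lam * (m * \<tau>)) * S 0 + E * m * exp (2 * \<bar>lam\<bar> * (m * \<tau>))
      \<le> exp (2 * lam * (m * \<tau>)) * (k * (e 0 s + k * \<delta>)) + E * m * exp (2 * \<bar>lam\<bar> * (m * \<tau>))"
    using S0 by (intro add_right_mono mult_left_mono) auto
  also have "\<dots> = k * (exp (2 * lam * (m * \<tau>)) * (e 0 s + k * \<delta>) + E * m / k * exp (2 * \<bar>lam\<bar> * (m * \<tau>)))"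
    using k by (simp add: field_simps)
  finally have "e m (s + m * \<tau>) - k * \<delta> \<le> exp (2 * lam * (m * \<tau>)) * (e 0 s + k * \<delta>) + E * m / k * exp (2 * \<bar>lam\<bar> * (m * \<tau>))"
    using k by (simp add: mult_le_cancel_left)
  moreover have "E * m / k = 2 * \<bar>lam\<bar> * \<omega> * (m * \<tau>) + 2 * \<omega> * m / k + c * (m * \<tau>)"
    using k by (simp add: E_def field_simps)
  ultimately show ?thesis by simp
qed

section \<open>Comparison of Euler paths with EVI solutions\<close>

lemma W2_abs_diff_le:
  assumes "\<mu> \<in> P2" "\<nu> \<in> P2" "\<sigma> \<in> P2"
  shows "\<bar>W2 \<mu> \<sigma> - W2 \<nu> \<sigma>\<bar> \<le> W2 \<mu> \<nu>"
  using W2_triangle[of \<mu> \<nu> \<sigma>] W2_triangle[of \<nu> \<mu> \<sigma>] W2_commute[of \<mu> \<nu>] assms by linarith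

lemma continuous_on_W2:
  assumes c: "W2_continuous_on I \<mu>" and P: "\<And>t. t \<in> I \<Longrightarrow> \<mu> t \<in> P2" "\<nu> \<in> P2"
  shows "continuous_on I (\<lambda>t. W2 (\<mu> t) \<nu>)"
  unfolding continuous_on_def
proof
  fix t assume t: "t \<in> I"
  show "((\<lambda>t. W2 (\<mu> t) \<nu>) \<longlongrightarrow> W2 (\<mu> t) \<nu>) (at t within I)"
  proof (rule metric_tendsto_imp_tendsto)
    show "((\<lambda>s. W2 (\<mu> s) (\<mu> t)) \<longlongrightarrow> 0) (at t within I)"
      using c t by (simp add: W2_continuous_on_def)
    have "dist (W2 (\<mu> s) \<nu>) (W2 (\<mu> t) \<nu>) \<le> dist (W2 (\<mu> s) (\<mu> t)) 0" if "s \<in> I" for s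
      using W2_abs_diff_le[OF P(1)[OF that] P(1)[OF t] P(2)] W2_nonneg[of "\<mu> s" "\<mu> t"]
      by (simp add: dist_real_def)
    then show "\<forall>\<^sub>F s in at t within I. dist (W2 (\<mu> s) \<nu>) (W2 (\<mu> t) \<nu>) \<le> dist (W2 (\<mu> s) (\<mu> t)) 0"
      by (auto simp: eventually_at_filter)
  qed
qed

text \<open>Joint continuity makes the Heine-Cantor theorem for real functions applicable to curves of
  measures.\<close>

lemma continuous_on_W2_pair:
  assumes c: "W2_continuous_on I \<mu>" "W2_continuous_on I \<nu>"
    and P: "\<And>t. t \<in> I \<Longrightarrow> \<mu> t \<in> P2" "\<And>t. t \<in> I \<Longrightarrow> \<nu> t \<in> P2"
  shows "continuous_on (I \<times> I) (\<lambda>z. W2 (\<mu> (fst z)) (\<nu> (snd z)))"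
  unfolding continuous_on_def
proof
  fix z assume z: "z \<in> I \<times> I"
  then have z': "fst z \<in> I" "snd z \<in> I" by auto
  let ?f = "\<lambda>z. W2 (\<mu> (fst z)) (\<nu> (snd z))"
  let ?g = "\<lambda>y. W2 (\<mu> (fst y)) (\<mu> (fst z)) + W2 (\<nu> (snd y)) (\<nu> (snd z))"
  have "continuous_on (I \<times> I) ?g"
    using z' P by (intro continuous_intros continuous_on_compose2[OF continuous_on_W2[OF c(1)]]
        continuous_on_compose2[OF continuous_on_W2[OF c(2)]]) auto
  then have "(?g \<longlongrightarrow> ?g z) (at z within I \<times> I)" using z unfolding continuous_on_def by (rule bspec)
  moreover have "?g z = 0" using P z' by (simp add: W2_self)
  ultimately have g: "(?g \<longlongrightarrow> 0) (at z within I \<times> I)" by simp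
  show "(?f \<longlongrightarrow> ?f z) (at z within I \<times> I)"
  proof (rule metric_tendsto_imp_tendsto[OF g])
    have "dist (?f y) (?f z) \<le> dist (?g y) 0" if "y \<in> I \<times> I" for y
    proof -
      have y: "fst y \<in> I" "snd y \<in> I" using that by auto
      have "\<bar>W2 (\<mu> (fst y)) (\<nu> (snd y)) - W2 (\<mu> (fst z)) (\<nu> (snd y))\<bar> \<le> W2 (\<mu> (fst y)) (\<mu> (fst z))"
        using P y z' by (intro W2_abs_diff_le) auto
      moreover have "\<bar>W2 (\<nu> (snd y)) (\<mu> (fst z)) - W2 (\<nu> (snd z)) (\<mu> (fst z))\<bar> \<le> W2 (\<nu> (snd y)) (\<nu> (snd z))"
        using P y z' by (intro W2_abs_diff_le) auto
      ultimately show ?thesis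
        using W2_commute[OF P(1)[OF z'(1)] P(2)[OF y(2)]] W2_commute[OF P(1)[OF z'(1)] P(2)[OF z'(2)]]
          W2_nonneg[of "\<mu> (fst y)" "\<mu> (fst z)"] W2_nonneg[of "\<nu> (snd y)" "\<nu> (snd z)"]
        unfolding dist_real_def by linarith
    qed
    then show "\<forall>\<^sub>F y in at z within I \<times> I. dist (?f y) (?f z) \<le> dist (?g y) 0"
      by (auto simp: eventually_at_filter)
  qed
qed

lemma W2_continuous_on_subset: "W2_continuous_on I \<mu> \<Longrightarrow> J \<subseteq> I \<Longrightarrow> W2_continuous_on J \<mu>"
  unfolding W2_continuous_on_def by (meson subsetD tendsto_within_subset)

lemma W2_uniformly_continuous:
  assumes c: "W2_continuous_on K \<mu>" and "compact K" and P: "\<And>t. t \<in> K \<Longrightarrow> \<mu> t \<in> P2" and "0 < \<omega>"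
  obtains d where "0 < d" "\<And>s t. s \<in> K \<Longrightarrow> t \<in> K \<Longrightarrow> \<bar>s - t\<bar> < d \<Longrightarrow> W2 (\<mu> s) (\<mu> t) < \<omega>"
proof -
  let ?f = "\<lambda>z. W2 (\<mu> (fst z)) (\<mu> (snd z))"
  have "uniformly_continuous_on (K \<times> K) ?f"
    by (intro compact_uniformly_continuous continuous_on_W2_pair compact_Times assms)
  then obtain d where d: "0 < d" "\<And>y z. y \<in> K \<times> K \<Longrightarrow> z \<in> K \<times> K \<Longrightarrow> dist y z < d \<Longrightarrow> dist (?f y) (?f z) < \<omega>"
    using \<open>0 < \<omega>\<close> unfolding uniformly_continuous_on_def by metis
  have "W2 (\<mu> s) (\<mu> t) < \<omega>" if "s \<in> K" "t \<in> K" "\<bar>s - t\<bar> < d" for s t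
    using d(2)[of "(s, t)" "(t, t)"] that by (simp add: dist_Pair_Pair dist_real_def W2_self P)
  then show ?thesis using that d(1) by blast
qed

lemma MPVF_facts:
  assumes "MPVF F" shows "\<Phi> \<in> F \<Longrightarrow> \<Phi> \<in> P2T" "\<nu> \<in> Dom F \<Longrightarrow> \<nu> \<in> P2"
  using assms base_in_P2 by (auto simp: MPVF_def Dom_def)

lemma EVI_solution_facts:
  assumes "EVI_solution lam F I \<mu>"
  shows "\<And>t. t \<in> I \<Longrightarrow> \<mu> t \<in> P2" "W2_continuous_on I \<mu>"
  using assms by (auto simp: EVI_solution_def W2_closure_def)

text \<open>The pairing in the EVI is replaced by the difference quotient with step \<open>\<tau>\<close>, which bounds it
  from below and is continuous in \<open>t\<close>; the pairing itself is only a pointwise limit of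
  continuous functions of \<open>t\<close>, which provides its measurability.\<close>

lemma EVI_increment:
  fixes T :: ereal
  assumes F: "MPVF F" and EVI: "EVI_solution lam F {t. 0 \<le> t \<and> ereal t < T} \<mu>"
    and \<Phi>: "\<Phi> \<in> F" and \<tau>: "0 < \<tau>" and ab: "0 < a" "a \<le> b" "ereal b < T"
  shows "(W2 (\<mu> b) (base \<Phi>))\<^sup>2 / 2 - (W2 (\<mu> a) (base \<Phi>))\<^sup>2 / 2
    \<le> integral {a..b} (\<lambda>t. lam * (W2 (\<mu> t) (base \<Phi>))\<^sup>2
        - ((W2 (\<mu> t) (exp_push \<tau> \<Phi>))\<^sup>2 - (W2 (\<mu> t) (base \<Phi>))\<^sup>2) / (2 * \<tau>) + \<tau> * (speed \<Phi>)\<^sup>2 / 2)"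
proof -
  define I where "I = {t. 0 \<le> t \<and> ereal t < T}"
  define J where "J = interior I"
  have EVI': "EVI_solution lam F I \<mu>" using EVI by (simp add: I_def)
  have \<Phi>T: "\<Phi> \<in> P2T" using MPVF_facts[OF F] \<Phi> by simp
  have pos: "{0<..} \<inter> {t. ereal t < T} \<subseteq> J"
    unfolding J_def I_def by (intro interior_maximal open_Int open_Collect_less continuous_intros) auto
  have sub: "{a..b} \<subseteq> J"
  proof
    fix t assume t: "t \<in> {a..b}"
    then have "ereal t \<le> ereal b" by simp
    then have "ereal t < T" using ab(3) by (rule le_less_trans)
    then show "t \<in> J" using t ab(1) by (intro subsetD[OF pos]) auto
  qed
  have JI: "J \<subseteq> I" by (simp add: J_def interior_subset)
  have \<mu>P: "\<mu> t \<in> P2" if "t \<in> J" for t using EVI_solution_facts(1)[OF EVI'] JI that by blast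
  have cont: "continuous_on J (\<lambda>t. W2 (\<mu> t) \<nu>)" if "\<nu> \<in> P2" for \<nu>
    by (rule continuous_on_W2[OF W2_continuous_on_subset[OF EVI_solution_facts(2)[OF EVI'] JI] \<mu>P that])
  note bP = base_in_P2[OF \<Phi>T] and eP = exp_push_in_P2[OF \<Phi>T]
  let ?u = "\<lambda>t. (1/2) * (W2 (\<mu> t) (base \<Phi>))\<^sup>2"
  let ?g = "\<lambda>t. lam * (W2 (\<mu> t) (base \<Phi>))\<^sup>2 - pairing_point \<Phi> (\<mu> t)"
  let ?l = "\<lambda>t. lam * (W2 (\<mu> t) (base \<Phi>))\<^sup>2 - speed \<Phi> * W2 (\<mu> t) (base \<Phi>)"
  let ?q = "\<lambda>s t. ((W2 (\<mu> t) (exp_push s \<Phi>))\<^sup>2 - (W2 (\<mu> t) (base \<Phi>))\<^sup>2) / (2 * s)"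
  let ?h = "\<lambda>t. lam * (W2 (\<mu> t) (base \<Phi>))\<^sup>2 - ?q \<tau> t + \<tau> * (speed \<Phi>)\<^sup>2 / 2"
  have comm: "W2 (exp_push s \<Phi>) (\<mu> t) = W2 (\<mu> t) (exp_push s \<Phi>)"
    "W2 (base \<Phi>) (\<mu> t) = W2 (\<mu> t) (base \<Phi>)" if "t \<in> J" for s t
    using \<mu>P[OF that] bP eP by (auto intro: W2_commute)
  have "?u b - ?u a \<le> integral {a..b} ?h"
  proof (rule distr_deriv_le_imp_increment_le[of J ?u ?g])
    show "distr_deriv_le J ?u ?g" using EVI' \<Phi> unfolding EVI_solution_def J_def by blast
    show "open J" by (simp add: J_def)
    show "continuous_on J ?u" "continuous_on J ?h" "continuous_on J ?l"
      using \<tau> by (auto intro!: continuous_intros cont bP eP)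
    show "?l t \<le> ?g t" if "t \<in> J" for t
      using pairing_point_upper_bound[OF \<Phi>T \<mu>P[OF that]] comm[OF that] by simp
    show "?g t \<le> ?h t" if "t \<in> J" for t
      using pairing_point_lower_bound[OF \<Phi>T \<mu>P[OF that] \<tau>] comm[OF that] by simp
    have J: "J \<in> sets borel" by (simp add: J_def)
    show "(\<lambda>t. indicator J t * ?g t) \<in> borel_measurable borel"
    proof (rule borel_measurable_LIMSEQ_real)
      let ?G = "\<lambda>n t. indicator J t * (lam * (W2 (\<mu> t) (base \<Phi>))\<^sup>2 - ?q (1 / real (Suc n)) t)"
      show "?G n \<in> borel_measurable borel" for n
        using borel_measurable_continuous_on_indicator[OF J, of "\<lambda>t. lam * (W2 (\<mu> t) (base \<Phi>))\<^sup>2 - ?q (1 / real (Suc n)) t"]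
        by (simp add: continuous_on_diff continuous_on_mult continuous_on_divide continuous_on_power cont bP eP)
      show "(\<lambda>n. ?G n t) \<longlonglongrightarrow> indicator J t * ?g t" for t
      proof (cases "t \<in> J")
        case True
        have "(\<lambda>n. 1 / real (Suc n)) \<longlonglongrightarrow> 0" by (rule LIMSEQ_Suc[OF lim_1_over_n])
        then have "filterlim (\<lambda>n. 1 / real (Suc n)) (at_right 0) sequentially"
          by (rule tendsto_imp_filterlim_at_right) simp
        from filterlim_compose[OF pairing_point_tendsto[OF \<Phi>T \<mu>P[OF True]] this]
        have "(\<lambda>n. ?q (1 / real (Suc n)) t) \<longlonglongrightarrow> pairing_point \<Phi> (\<mu> t)"
          unfolding comm[OF True] .
        then show ?thesis by (intro tendsto_intros)
      qed simp
    qed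
  qed (use ab sub in auto)
  then show ?thesis by simp
qed

text \<open>The step is \<open>\<tau> = h / (p k)\<close>, the window of \<open>k\<close> rows has width \<open>h / p\<close>, and \<open>p\<close> is fixed before
  \<open>k\<close> tends to infinity.  The width \<open>h / p\<close> controls the averaging error; the
  remaining errors are governed by the oscillation of \<open>\<mu>\<close> over one step, multiplied by
  \<open>p\<close>, and by \<open>\<tau> L\<^sup>2\<close>.  The assumption \<open>2 h \<le> Tb\<close> leaves room for the window beyond time \<open>h\<close>.\<close>

lemma Euler_follows_EVI:
  fixes T :: ereal
  assumes F: "MPVF F" and EVI: "EVI_solution lam F {t. 0 \<le> t \<and> ereal t < T} \<mu>"
    and t0: "0 < t0" "0 < h" "ereal (t0 + h) < T" and M0: "M0 \<in> Dom F" and L: "0 < L" and Tb: "2 * h \<le> Tb"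
    and \<eta>: "0 < \<eta>"
  shows "\<forall>\<^sub>F p in sequentially. \<forall>\<^sub>F k in sequentially. \<forall>M \<Phi>.
    stable_discrete_solution F L Tb (h / (real p * real k)) M0 M \<Phi> \<longrightarrow>
      M (p * k) \<in> P2 \<and> (W2 (\<mu> (t0 + h)) (M (p * k)))\<^sup>2 \<le> exp (2 * lam * h) * (W2 (\<mu> t0) M0)\<^sup>2 + \<eta>"
proof -
  define K where "K = {t0..t0 + h}"
  define I where "I = {t. 0 \<le> t \<and> ereal t < T}"
  have EVI': "EVI_solution lam F I \<mu>" using EVI by (simp add: I_def)
  have KI: "K \<subseteq> I"
  proof
    fix t assume "t \<in> K"
    then have "0 \<le> t" "ereal t \<le> ereal (t0 + h)" using t0 by (auto simp: K_def)
    from this(2) t0(3) have "ereal t < T" by (rule le_less_trans)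
    then show "t \<in> I" using \<open>0 \<le> t\<close> by (simp add: I_def)
  qed
  have \<mu>P: "\<mu> t \<in> P2" if "t \<in> K" for t using EVI_solution_facts(1)[OF EVI'] KI that by blast
  have \<mu>c: "W2_continuous_on K \<mu>" using W2_continuous_on_subset[OF EVI_solution_facts(2)[OF EVI'] KI] .
  have M0P: "M0 \<in> P2" using MPVF_facts(2)[OF F M0] .
  have "compact K" by (simp add: K_def)
  then have "bounded ((\<lambda>t. W2 (\<mu> t) M0) ` K)"
    by (intro compact_imp_bounded compact_continuous_image continuous_on_W2[OF \<mu>c \<mu>P M0P])
  then obtain B where B: "\<And>t. t \<in> K \<Longrightarrow> \<bar>W2 (\<mu> t) M0\<bar> \<le> B" unfolding bounded_iff by auto
  \<comment> \<open>Up to the end of the window, at time at most 2 h, the Euler path stays within 2 h L of its start.\<close>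
  define C where "C = B + 2 * h * L"
  have "0 \<le> B" using B[of t0] t0 by (force simp: K_def)
  then have C: "0 \<le> C" using t0 L by (simp add: C_def)
  have ev0: "\<forall>\<^sub>F n in sequentially. X / real n < y" if "0 < y" for X y :: real
    using lim_const_over_n[of X] that by (intro order_tendstoD) auto
  have p0: "\<forall>\<^sub>F p in sequentially. 0 < p \<and> C * L * h * (1 + exp (2 * lam * h)) / real p < \<eta> / 8"
    using \<eta> by (intro eventually_conj ev0 eventually_gt_at_top) auto
  show ?thesis using p0
  proof eventually_elim
    case (elim p)
    define E where "E = exp (2 * \<bar>lam\<bar> * h)"
    define Y where "Y = (2 * \<bar>lam\<bar> * C * h + 2 * C * p) * E"
    have "0 \<le> Y" using C t0 by (simp add: Y_def E_def)
    \<comment> \<open>Y collects all factors that multiply the oscillation; adding 1 avoids a division by zero.\<close>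
    define \<omega> where "\<omega> = \<eta> / (8 * (Y + 1))"
    have \<omega>: "0 < \<omega>" "\<omega> * Y \<le> \<eta> / 8" using \<eta> \<open>0 \<le> Y\<close> by (auto simp: \<omega>_def field_simps)
    obtain d where d: "0 < d" "\<And>s t. s \<in> K \<Longrightarrow> t \<in> K \<Longrightarrow> \<bar>s - t\<bar> < d \<Longrightarrow> W2 (\<mu> s) (\<mu> t) < \<omega>"
      using W2_uniformly_continuous[OF \<mu>c \<open>compact K\<close> \<mu>P \<omega>(1)] by blast
    have k0: "\<forall>\<^sub>F k in sequentially. 0 < k \<and> h / real p / real k < d \<and> h * L\<^sup>2 / 2 * h * E / real p / real k < \<eta> / 8"
      using \<eta> d(1) by (intro eventually_conj ev0 eventually_gt_at_top) auto
    show ?case using k0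
    proof eventually_elim
      case (elim k)
      show ?case
      proof (intro allI impI)
        fix M \<Phi>
        assume sol: "stable_discrete_solution F L Tb (h / (real p * real k)) M0 M \<Phi>"
        define \<tau> where "\<tau> = h / (real p * real k)"
        define m where "m = p * k"
        have pk: "0 < p" "0 < k" using \<open>0 < p \<and> _\<close> elim by auto
        have \<tau>: "0 < \<tau>" "\<tau> < d" using t0 pk elim by (auto simp: \<tau>_def)
        have m\<tau>: "real m * \<tau> = h" using pk by (simp add: m_def \<tau>_def)
        have k\<tau>: "real k * \<tau> = h / p" using pk by (simp add: \<tau>_def)
        have "h / p \<le> h" using pk t0 by (simp add: divide_simps)
        then have mk: "real (m + k) * \<tau> \<le> 2 * h" using m\<tau> k\<tau> by (simp add: distrib_right)
        then have "real (m + k) * \<tau> \<le> Tb" using Tb by simp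
        then have "real (m + k) \<le> Tb / \<tau>" using \<tau> by (simp add: pos_le_divide_eq)
        then have N: "m + k \<le> nat \<lceil>Tb / \<tau>\<rceil>" by linarith
        have sol0: "M 0 = M0" and solD: "\<And>n. n \<le> m + k \<Longrightarrow> M n \<in> Dom F"
          and sol\<Phi>: "\<And>n. n < m + k \<Longrightarrow> \<Phi> n \<in> F \<and> base (\<Phi> n) = M n \<and> speed (\<Phi> n) \<le> L \<and> M (Suc n) = exp_push \<tau> (\<Phi> n)"
          using sol N unfolding stable_discrete_solution_def \<tau>_def[symmetric] section_at_def Let_def by auto
        have MP: "M n \<in> P2" if "n \<le> m + k" for n using MPVF_facts(2)[OF F solD[OF that]] .
        have MS: "W2 (M (Suc n)) (M n) \<le> L * \<tau>" if "n < m + k" for n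
        proof -
          have "\<Phi> n \<in> P2T" using sol\<Phi>[OF that] MPVF_facts(1)[OF F] by blast
          then have "W2 (exp_push \<tau> (\<Phi> n)) (exp_push 0 (\<Phi> n)) \<le> \<bar>\<tau> - 0\<bar> * speed (\<Phi> n)"
            by (rule W2_exp_push_Lipschitz)
          also have "\<dots> \<le> \<tau> * L" using sol\<Phi>[OF that] \<tau> by simp
          finally show ?thesis using sol\<Phi>[OF that] by (simp add: base_eq_exp_push_0 mult.commute)
        qed
        have M0n: "W2 (M n) M0 \<le> real n * (L * \<tau>)" if "n \<le> m + k" for n
          using that
        proof (induction n)
          case 0 then show ?case using W2_self[OF M0P] sol0 by simp
        next
          case (Suc n)
          then have "W2 (M (Suc n)) M0 \<le> W2 (M (Suc n)) (M n) + W2 (M n) M0"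
            by (intro W2_triangle MP M0P) auto
          then show ?case using Suc MS[of n] by (simp add: algebra_simps)
        qed
        have C_bound: "W2 (\<mu> t) (M n) \<le> C" if "t \<in> K" "n \<le> m + k" for t n
        proof -
          have "real n * (L * \<tau>) \<le> real (m + k) * (L * \<tau>)"
            using that(2) L \<tau> by (intro mult_right_mono) auto
          also have "\<dots> = L * (real (m + k) * \<tau>)" by simp
          also have "\<dots> \<le> L * (2 * h)" using mk L by (intro mult_left_mono) auto
          finally have "W2 (M n) M0 \<le> 2 * h * L" using M0n[OF that(2)] by (simp add: mult.commute)
          moreover have "W2 (\<mu> t) (M n) \<le> W2 (\<mu> t) M0 + W2 M0 (M n)"
            using \<mu>P[OF that(1)] M0P MP[OF that(2)] by (intro W2_triangle)
          ultimately show ?thesis using B[OF that(1)] W2_commute[OF M0P MP[OF that(2)]] by (simp add: C_def)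
        qed
        define e where "e n t = (W2 (\<mu> t) (M n))\<^sup>2 / 2" for n t
        have sq: "\<bar>x\<^sup>2 / 2 - y\<^sup>2 / 2\<bar> \<le> C * z" if "0 \<le> x" "x \<le> C" "0 \<le> y" "y \<le> C" "\<bar>x - y\<bar> \<le> z" for x y z
        proof -
          have "\<bar>x\<^sup>2 / 2 - y\<^sup>2 / 2\<bar> = (x + y) / 2 * \<bar>x - y\<bar>"
          proof -
            have eq: "x\<^sup>2 / 2 - y\<^sup>2 / 2 = (x + y) / 2 * (x - y)" by (simp add: power2_eq_square algebra_simps)
            show ?thesis using that unfolding eq abs_mult by simp
          qed
          also have "\<dots> \<le> C * z" using that by (intro mult_mono) auto
          finally show ?thesis .
        qed
        have "e m (t0 + real m * \<tau>) \<le> exp (2 * lam * (real m * \<tau>)) * (e 0 t0 + k * (C * (L * \<tau>))) + k * (C * (L * \<tau>))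
          + (2 * \<bar>lam\<bar> * (C * \<omega>) * (real m * \<tau>) + 2 * (C * \<omega>) * m / k + \<tau> * L\<^sup>2 / 2 * (real m * \<tau>)) * exp (2 * \<bar>lam\<bar> * (real m * \<tau>))"
        proof (rule staircase_estimate[OF \<tau>(1) pk(2)])
          show "0 \<le> e n t" for n t by (simp add: e_def)
          show "0 \<le> C * \<omega>" using C \<omega> by simp
          show "0 \<le> \<tau> * L\<^sup>2 / 2" using \<tau> by simp
          show cont: "continuous_on {t0..t0 + real m * \<tau>} (e n)" if "n \<le> m + k" for n
            unfolding m\<tau> K_def[symmetric] e_def
            by (intro continuous_intros continuous_on_W2[OF \<mu>c \<mu>P MP[OF that]]) auto
          show "e n b - e n a \<le> integral {a..b} (\<lambda>t. 2 * lam * e n t - (e (Suc n) t - e n t) / \<tau> + \<tau> * L\<^sup>2 / 2)"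
            if n: "n < m + k" and ab: "t0 \<le> a" "a \<le> b" "b \<le> t0 + real m * \<tau>" for n a b
          proof -
            have \<Phi>: "\<Phi> n \<in> F" "base (\<Phi> n) = M n" "speed (\<Phi> n) \<le> L" "exp_push \<tau> (\<Phi> n) = M (Suc n)"
              using sol\<Phi>[OF n] by auto
            have bT: "ereal b < T"
            proof -
              have "ereal b \<le> ereal (t0 + h)" using ab m\<tau> by simp
              then show ?thesis using t0(3) by (rule le_less_trans)
            qed
            have "e n b - e n a \<le> integral {a..b} (\<lambda>t. lam * (W2 (\<mu> t) (M n))\<^sup>2
                - ((W2 (\<mu> t) (M (Suc n)))\<^sup>2 - (W2 (\<mu> t) (M n))\<^sup>2) / (2 * \<tau>) + \<tau> * (speed (\<Phi> n))\<^sup>2 / 2)"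
              using EVI_increment[OF F EVI \<Phi>(1) \<tau>(1) _ ab(2) bT] ab t0 unfolding \<Phi>(2,4) e_def by simp
            also have "\<dots> \<le> integral {a..b} (\<lambda>t. 2 * lam * e n t - (e (Suc n) t - e n t) / \<tau> + \<tau> * L\<^sup>2 / 2)"
            proof (rule integral_le)
              have sub: "{a..b} \<subseteq> K" using ab m\<tau> by (auto simp: K_def)
              have c: "continuous_on {a..b} (\<lambda>t. W2 (\<mu> t) (M j))" if "j \<le> m + k" for j
                by (rule continuous_on_subset[OF continuous_on_W2[OF \<mu>c \<mu>P MP[OF that]] sub])
              show "(\<lambda>t. lam * (W2 (\<mu> t) (M n))\<^sup>2
                - ((W2 (\<mu> t) (M (Suc n)))\<^sup>2 - (W2 (\<mu> t) (M n))\<^sup>2) / (2 * \<tau>) + \<tau> * (speed (\<Phi> n))\<^sup>2 / 2) integrable_on {a..b}"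
                using n \<tau> by (intro integrable_continuous_real continuous_intros c) auto
              show "(\<lambda>t. 2 * lam * e n t - (e (Suc n) t - e n t) / \<tau> + \<tau> * L\<^sup>2 / 2) integrable_on {a..b}"
                unfolding e_def using n \<tau> by (intro integrable_continuous_real continuous_intros c) auto
              fix t
              have "\<tau> * (speed (\<Phi> n))\<^sup>2 / 2 \<le> \<tau> * L\<^sup>2 / 2"
                using \<Phi>(3) speed_nonneg[of "\<Phi> n"] \<tau> by (intro divide_right_mono mult_left_mono power_mono) auto
              moreover have "((W2 (\<mu> t) (M (Suc n)))\<^sup>2 - (W2 (\<mu> t) (M n))\<^sup>2) / (2 * \<tau>) = (e (Suc n) t - e n t) / \<tau>"
                using \<tau> by (simp add: e_def field_simps)
              ultimately show "lam * (W2 (\<mu> t) (M n))\<^sup>2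
                - ((W2 (\<mu> t) (M (Suc n)))\<^sup>2 - (W2 (\<mu> t) (M n))\<^sup>2) / (2 * \<tau>) + \<tau> * (speed (\<Phi> n))\<^sup>2 / 2
                \<le> 2 * lam * e n t - (e (Suc n) t - e n t) / \<tau> + \<tau> * L\<^sup>2 / 2"
                by (simp add: e_def)
            qed
            finally show ?thesis .
          qed
          show "\<bar>e n x - e n y\<bar> \<le> C * \<omega>"
            if "n \<le> m + k" "x \<in> {t0..t0 + real m * \<tau>}" "y \<in> {t0..t0 + real m * \<tau>}" "\<bar>x - y\<bar> \<le> \<tau>" for n x y
          proof -
            have xy: "x \<in> K" "y \<in> K" using that m\<tau> by (auto simp: K_def)
            have "W2 (\<mu> x) (\<mu> y) < \<omega>" using that \<tau> xy by (intro d(2)) auto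
            then show ?thesis unfolding e_def
              using W2_abs_diff_le[OF \<mu>P[OF xy(1)] \<mu>P[OF xy(2)] MP[OF that(1)]] that(1) xy
              by (intro sq W2_nonneg C_bound) auto
          qed
          show "\<bar>e (Suc n) t - e n t\<bar> \<le> C * (L * \<tau>)" if "n < m + k" "t \<in> {t0..t0 + real m * \<tau>}" for n t
          proof -
            have t: "t \<in> K" using that m\<tau> by (simp add: K_def)
            have "\<bar>W2 (\<mu> t) (M (Suc n)) - W2 (\<mu> t) (M n)\<bar> \<le> L * \<tau>"
              using W2_abs_diff_le[of "M (Suc n)" "M n" "\<mu> t"] MS[OF that(1)] MP[of "Suc n"] MP[of n] \<mu>P[OF t] that(1)
                W2_commute[of "\<mu> t" "M n"] W2_commute[of "\<mu> t" "M (Suc n)"] by simp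
            then show ?thesis unfolding e_def using that(1) t by (intro sq W2_nonneg C_bound) auto
          qed
        qed
        also have "real k * (C * (L * \<tau>)) = C * L * h / p" using k\<tau> by (simp add: algebra_simps)
        also have "2 * (C * \<omega>) * real m / k = 2 * (C * \<omega>) * p" using pk by (simp add: m_def)
        also have "real m * \<tau> = h" by (rule m\<tau>)
        finally have "e m (t0 + h) \<le> exp (2 * lam * h) * e 0 t0 + C * L * h * (1 + exp (2 * lam * h)) / p
            + \<omega> * Y + \<tau> * L\<^sup>2 / 2 * h * E"
          by (simp add: Y_def E_def algebra_simps add_divide_distrib)
        also have "\<tau> * L\<^sup>2 / 2 * h * E = h * L\<^sup>2 / 2 * h * E / real p / real k" by (simp add: \<tau>_def)
        finally have "e m (t0 + h) \<le> exp (2 * lam * h) * e 0 t0 + \<eta> / 2"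
          using conjunct2[OF \<open>0 < p \<and> _\<close>] conjunct2[OF conjunct2[OF elim]] \<omega>(2) \<eta> by linarith
        then show "M (p * k) \<in> P2 \<and> (W2 (\<mu> (t0 + h)) (M (p * k)))\<^sup>2 \<le> exp (2 * lam * h) * (W2 (\<mu> t0) M0)\<^sup>2 + \<eta>"
          using MP[of m] unfolding e_def sol0 m_def by simp
      qed
    qed
  qed
qed

text \<open>One Euler path serves both curves: it starts on \<open>\<mu>1\<close> and therefore follows \<open>\<mu>1\<close>, while its
  distance from \<open>\<mu>2\<close> grows at most by the factor \<open>exp (lam h)\<close>.\<close>

lemma EVI_locally_contractive:
  fixes T :: ereal
  assumes F: "MPVF F" and EVI1: "EVI_solution lam F {t. 0 \<le> t \<and> ereal t < T} \<mu>1"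
    and EVI2: "EVI_solution lam F {t. 0 \<le> t \<and> ereal t < T} \<mu>2"
    and t0: "0 < t0" "ereal t0 < T" and D: "\<mu>1 t0 \<in> Dom F" and E: "Euler_locally_solvable_at F (\<mu>1 t0)"
  obtains H where "0 < H" "\<And>h. 0 \<le> h \<Longrightarrow> h < H \<Longrightarrow> ereal (t0 + h) < T \<Longrightarrow>
    W2 (\<mu>1 (t0 + h)) (\<mu>2 (t0 + h)) \<le> exp (lam * h) * W2 (\<mu>1 t0) (\<mu>2 t0)"
proof -
  obtain \<tau>b Tb L where c: "0 < \<tau>b" "0 < Tb" "0 < L"
    and ex: "\<And>\<tau>. 0 < \<tau> \<Longrightarrow> \<tau> < \<tau>b \<Longrightarrow> \<exists>M \<Phi>. stable_discrete_solution F L Tb \<tau> (\<mu>1 t0) M \<Phi>"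
    using E unfolding Euler_locally_solvable_at_def by blast
  have P: "\<mu>1 t \<in> P2" "\<mu>2 t \<in> P2" if "0 \<le> t" "ereal t < T" for t
    using EVI_solution_facts(1)[OF EVI1, of t] EVI_solution_facts(1)[OF EVI2, of t] that by auto
  have "W2 (\<mu>1 (t0 + h)) (\<mu>2 (t0 + h)) \<le> exp (lam * h) * W2 (\<mu>1 t0) (\<mu>2 t0)"
    if h: "0 < h" "h < Tb / 2" "ereal (t0 + h) < T" for h
  proof (rule field_le_epsilon)
    fix \<epsilon> :: real assume \<epsilon>: "0 < \<epsilon>"
    \<comment> \<open>The error is squared because the comparison is between squared distances.\<close>
    define \<eta> where "\<eta> = (\<epsilon> / 2)\<^sup>2"
    have \<eta>: "0 < \<eta>" using \<epsilon> by (simp add: \<eta>_def)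
    have h2: "2 * h \<le> Tb" using h by simp
    let ?A = "\<lambda>\<mu> p k. \<forall>M \<Phi>. stable_discrete_solution F L Tb (h / (real p * real k)) (\<mu>1 t0) M \<Phi> \<longrightarrow>
      M (p * k) \<in> P2 \<and> (W2 (\<mu> (t0 + h)) (M (p * k)))\<^sup>2 \<le> exp (2 * lam * h) * (W2 (\<mu> t0) (\<mu>1 t0))\<^sup>2 + \<eta>"
    have "\<forall>\<^sub>F p in sequentially. 0 < p \<and> (\<forall>\<^sub>F k in sequentially. ?A \<mu>1 p k) \<and> (\<forall>\<^sub>F k in sequentially. ?A \<mu>2 p k)"
      using Euler_follows_EVI[OF F EVI1 t0(1) h(1,3) D c(3) h2 \<eta>] Euler_follows_EVI[OF F EVI2 t0(1) h(1,3) D c(3) h2 \<eta>]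
      by (intro eventually_conj eventually_gt_at_top)
    then obtain p where p: "0 < p" "\<forall>\<^sub>F k in sequentially. ?A \<mu>1 p k" "\<forall>\<^sub>F k in sequentially. ?A \<mu>2 p k"
      using eventually_happens'[OF sequentially_bot] by blast
    have "\<forall>\<^sub>F k in sequentially. h / p / real k < \<tau>b"
      using lim_const_over_n[of "h / p"] c(1) by (intro order_tendstoD) auto
    then have "\<forall>\<^sub>F k in sequentially. 0 < k \<and> h / p / real k < \<tau>b \<and> ?A \<mu>1 p k \<and> ?A \<mu>2 p k"
      using p by (intro eventually_conj eventually_gt_at_top)
    then obtain k where k: "0 < k" "h / p / real k < \<tau>b" "?A \<mu>1 p k" "?A \<mu>2 p k"
      using eventually_happens'[OF sequentially_bot] by blast
    obtain M \<Phi> where M: "stable_discrete_solution F L Tb (h / (real p * real k)) (\<mu>1 t0) M \<Phi>"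
      using ex[of "h / (real p * real k)"] k(1,2) p(1) h by auto
    define m where "m = M (p * k)"
    have m: "m \<in> P2" "(W2 (\<mu>1 (t0 + h)) m)\<^sup>2 \<le> exp (2 * lam * h) * (W2 (\<mu>1 t0) (\<mu>1 t0))\<^sup>2 + \<eta>"
      "(W2 (\<mu>2 (t0 + h)) m)\<^sup>2 \<le> exp (2 * lam * h) * (W2 (\<mu>2 t0) (\<mu>1 t0))\<^sup>2 + \<eta>"
      using k(3,4) M unfolding m_def by blast+
    note P0 = P[of t0] and Ph = P[of "t0 + h"]
    have P': "\<mu>1 t0 \<in> P2" "\<mu>2 t0 \<in> P2" "\<mu>1 (t0 + h) \<in> P2" "\<mu>2 (t0 + h) \<in> P2"
      using P0 Ph t0 h by auto
    let ?w = "exp (lam * h) * W2 (\<mu>1 t0) (\<mu>2 t0)"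
    have "(W2 (\<mu>1 (t0 + h)) m)\<^sup>2 \<le> (\<epsilon> / 2)\<^sup>2" using m(2) W2_self[OF P'(1)] by (simp add: \<eta>_def)
    then have 1: "W2 (\<mu>1 (t0 + h)) m \<le> \<epsilon> / 2" by (rule power2_le_imp_le) (use \<epsilon> in simp)
    have w: "0 \<le> ?w" using W2_nonneg[of "\<mu>1 t0" "\<mu>2 t0"] by simp
    have "(W2 (\<mu>2 (t0 + h)) m)\<^sup>2 \<le> ?w\<^sup>2 + (\<epsilon> / 2)\<^sup>2"
      using m(3) W2_commute[OF P'(1,2)] by (simp add: \<eta>_def power_mult_distrib exp_double[symmetric] mult.assoc)
    also have "\<dots> \<le> (?w + \<epsilon> / 2)\<^sup>2" using mult_nonneg_nonneg[OF w less_imp_le[OF \<epsilon>]] by (simp add: power2_sum mult.assoc)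
    finally have 2: "W2 (\<mu>2 (t0 + h)) m \<le> ?w + \<epsilon> / 2" by (rule power2_le_imp_le) (use w \<epsilon> in simp)
    have "W2 (\<mu>1 (t0 + h)) (\<mu>2 (t0 + h)) \<le> W2 (\<mu>1 (t0 + h)) m + W2 m (\<mu>2 (t0 + h))"
      by (intro W2_triangle P' m)
    then show "W2 (\<mu>1 (t0 + h)) (\<mu>2 (t0 + h)) \<le> ?w + \<epsilon>"
      using 1 2 W2_commute[OF m(1) P'(4)] by simp
  qed
  then have "W2 (\<mu>1 (t0 + h)) (\<mu>2 (t0 + h)) \<le> exp (lam * h) * W2 (\<mu>1 t0) (\<mu>2 t0)"
    if "0 \<le> h" "h < Tb / 2" "ereal (t0 + h) < T" for h
    using that by (cases "h = 0") auto
  then show ?thesis using that[of "Tb / 2"] c(2) by simp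
qed

text \<open>By the local estimate, \<open>exp (- lam t) W2(\<mu>1 t, \<mu>2 t)\<close> does not exceed its value at any positive
  time shortly afterwards, so it decreases on \<open>(0, b]\<close>.  The initial time, at which \<open>\<mu>1\<close> may lie
  outside the domain, is reached by continuity.\<close>

lemma EVI_contractive:
  fixes T :: ereal
  assumes F: "MPVF F" and I: "I = {t. 0 \<le> t \<and> ereal t < T}"
    and EVI: "EVI_solution lam F I \<mu>1" "EVI_solution lam F I \<mu>2"
    and E: "\<forall>\<mu>0\<in>Dom F. Euler_locally_solvable_at F \<mu>0" and strict: "strict_on F I \<mu>1" and b: "b \<in> I"
  shows "W2 (\<mu>1 b) (\<mu>2 b) \<le> W2 (\<mu>1 0) (\<mu>2 0) * exp (lam * b)"
proof -
  define f where "f t = exp (- lam * t) * W2 (\<mu>1 t) (\<mu>2 t)" for t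
  have b': "0 \<le> b" "ereal b < T" using b by (auto simp: I)
  have sub: "{0..b} \<subseteq> I"
  proof
    fix t assume t: "t \<in> {0..b}"
    then have "ereal t \<le> ereal b" by simp
    then have "ereal t < T" using b'(2) by (rule le_less_trans)
    then show "t \<in> I" using t unfolding I by simp
  qed
  have pair: "continuous_on (I \<times> I) (\<lambda>z. W2 (\<mu>1 (fst z)) (\<mu>2 (snd z)))"
    by (intro continuous_on_W2_pair EVI_solution_facts[OF EVI(1)] EVI_solution_facts[OF EVI(2)])
  have "continuous_on I (\<lambda>t. (t, t))" by (intro continuous_intros)
  from continuous_on_compose2[OF pair this] have "continuous_on I (\<lambda>t. W2 (\<mu>1 t) (\<mu>2 t))"
    by auto
  then have cont: "continuous_on {0..b} f" unfolding f_def
    using continuous_on_subset sub by (auto intro!: continuous_intros)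
  have dec: "f b \<le> f a" if a: "0 < a" "a \<le> b" for a
  proof (rule le_start_if_locally_le[OF a(2)])
    show "continuous_on {a..b} f" using a by (intro continuous_on_subset[OF cont]) auto
    fix t assume t: "a \<le> t" "t < b"
    have tI: "t \<in> I" "0 \<in> I" using sub t a b by auto
    \<comment> \<open>Strictness excludes the initial time, hence the restriction to positive a.\<close>
    have "(INF s\<in>I. ereal s) \<le> ereal 0" using tI by (intro INF_lower)
    also have "\<dots> < ereal t" using t a by simp
    finally have D: "\<mu>1 t \<in> Dom F" using strict tI unfolding strict_on_def by blast
    obtain H where H: "0 < H" "\<And>h. 0 \<le> h \<Longrightarrow> h < H \<Longrightarrow> ereal (t + h) < T \<Longrightarrow>
        W2 (\<mu>1 (t + h)) (\<mu>2 (t + h)) \<le> exp (lam * h) * W2 (\<mu>1 t) (\<mu>2 t)"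
      using EVI_locally_contractive[OF F EVI[unfolded I] _ _ D] t a tI E D unfolding I by auto
    show "\<exists>H>0. \<forall>h. 0 \<le> h \<and> h < H \<and> t + h \<le> b \<longrightarrow> f (t + h) \<le> f t"
    proof (intro exI[of _ H] conjI allI impI)
      fix h assume h: "0 \<le> h \<and> h < H \<and> t + h \<le> b"
      have "t + h \<in> I" using h t a by (intro subsetD[OF sub]) auto
      then have "W2 (\<mu>1 (t + h)) (\<mu>2 (t + h)) \<le> exp (lam * h) * W2 (\<mu>1 t) (\<mu>2 t)"
        using H(2)[of h] h unfolding I by simp
      then have "f (t + h) \<le> exp (- lam * (t + h)) * (exp (lam * h) * W2 (\<mu>1 t) (\<mu>2 t))"
        unfolding f_def by (intro mult_left_mono) auto
      also have "\<dots> = f t" unfolding f_def mult.assoc[symmetric] exp_add[symmetric] by (simp add: algebra_simps)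
      finally show "f (t + h) \<le> f t" .
    qed (rule H(1))
  qed
  have "f b \<le> f 0"
  proof (cases "b = 0")
    case False
    then have "0 < b" using b' by simp
    have "(f \<longlongrightarrow> f 0) (at 0 within {0..b})" using cont \<open>0 < b\<close> by (simp add: continuous_on_def)
    then have "(f \<longlongrightarrow> f 0) (at_right 0)" using \<open>0 < b\<close> by (simp add: at_within_Icc_at_right)
    moreover have "\<forall>\<^sub>F t in at_right 0. f b \<le> f t"
      unfolding eventually_at_right_field using dec \<open>0 < b\<close> less_imp_le by blast
    ultimately show ?thesis by (rule tendsto_lowerbound) simp
  qed simp
  then have "exp (lam * b) * f b \<le> exp (lam * b) * f 0" by (intro mult_left_mono) auto
  moreover have "exp (lam * b) * f b = W2 (\<mu>1 b) (\<mu>2 b)"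
    unfolding f_def mult.assoc[symmetric] exp_add[symmetric] by simp
  moreover have "exp (lam * b) * f 0 = W2 (\<mu>1 0) (\<mu>2 0) * exp (lam * b)"
    by (simp add: f_def mult.commute)
  ultimately show ?thesis by linarith
qed

theorem theorem6p15:
  fixes F :: "('a::{real_inner, polish_space} \<times> 'a) measure set"
    and lam :: real and T :: ereal and I :: "real set"
    and \<mu>1 \<mu>2 :: "real \<Rightarrow> 'a measure"
  assumes "MPVF F"
    and "dissipative lam F"
    and "\<forall>\<mu>0\<in>Dom F. Euler_locally_solvable_at F \<mu>0"
    and "0 < T" and "I = {t. 0 \<le> t \<and> ereal t < T}"
    and "EVI_solution lam F I \<mu>1"
    and "EVI_solution lam F I \<mu>2"
  shows "(strict_on F I \<mu>1 \<longrightarrow>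
            (\<forall>t\<in>I. W2 (\<mu>1 t) (\<mu>2 t) \<le> W2 (\<mu>1 0) (\<mu>2 0) * exp (max lam 0 * t)) \<and>
            (\<mu>1 0 = \<mu>2 0 \<longrightarrow> (\<forall>t\<in>I. \<mu>1 t = \<mu>2 t))) \<and>
         (strict_on F I \<mu>1 \<and> strict_on F I \<mu>2 \<longrightarrow>
            (\<forall>t\<in>I. W2 (\<mu>1 t) (\<mu>2 t) \<le> W2 (\<mu>1 0) (\<mu>2 0) * exp (lam * t)))"
proof -
  have est: "W2 (\<mu>1 t) (\<mu>2 t) \<le> W2 (\<mu>1 0) (\<mu>2 0) * exp (lam * t)" if "strict_on F I \<mu>1" "t \<in> I" for t
    using EVI_contractive[OF assms(1,5,6,7,3) that] .
  have P: "\<mu>1 t \<in> P2" "\<mu>2 t \<in> P2" if "t \<in> I" for t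
    using EVI_solution_facts(1) assms(6,7) that by blast+
  have "W2 (\<mu>1 t) (\<mu>2 t) \<le> W2 (\<mu>1 0) (\<mu>2 0) * exp (max lam 0 * t)" if "strict_on F I \<mu>1" "t \<in> I" for t
  proof -
    have "0 \<le> t" using that(2) assms(5) by simp
    then have "exp (lam * t) \<le> exp (max lam 0 * t)" by (simp add: mult_right_mono)
    then have "W2 (\<mu>1 0) (\<mu>2 0) * exp (lam * t) \<le> W2 (\<mu>1 0) (\<mu>2 0) * exp (max lam 0 * t)"
      by (intro mult_left_mono W2_nonneg)
    with est[OF that] show ?thesis by linarith
  qed
  moreover have "\<mu>1 t = \<mu>2 t" if "strict_on F I \<mu>1" "\<mu>1 0 = \<mu>2 0" "t \<in> I" for t
  proof (rule W2_zero_imp_eq[OF P[OF that(3)]])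
    have "0 \<in> I" using assms(4,5) by (simp add: zero_ereal_def[symmetric])
    then have "W2 (\<mu>1 0) (\<mu>2 0) = 0" using W2_self P(1) that(2) by metis
    then show "W2 (\<mu>1 t) (\<mu>2 t) = 0" using est[OF that(1,3)] W2_nonneg[of "\<mu>1 t" "\<mu>2 t"] by simp
  qed
  ultimately show ?thesis using est by blast
qed

end
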